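(* In the setting below, there exists a constant $A>0$ such that, as $t\nearrow T$, $$\frac{J_{\mathcal G}(t)}{(T-t)^{4/3}}\to A,\quad \frac{\dot J_{\mathcal G}(t)}{(T-t)^{1/3}}\to-\frac{4A}{3},\quad \frac{\ddot J_{\mathcal G}(t)}{(T-t)^{-2/3}}\to\frac{4A}{9},\quad \frac{U_{\mathcal G}(t)}{(T-t)^{-2/3}}\to\frac{2A}{9},\quad \frac{K_{\mathcal G}(t)}{(T-t)^{-2/3}}\to\frac{2A}{9}.$$ Moreover $H_{\mathcal G}(t)=K_{\mathcal G}(t)-U_{\mathcal G}(t)$ has a finite limit as $t\nearrow T$.
   Context: Setting: let $d\in\{2,3\}$, $n\ge2$, masses $m_1,\dots,m_n>0$, and let $q(t)=(q_1(t),\dots,q_n(t))$, $q_i(t)\in\mathbb{R}^d$, be a solution on $[t_0,T)$ of $m_i\ddot q_i=\partial U/\partial q_i$, $U(q)=\sum_{i<j}m_im_j/|q_i-q_j|$, with $q_i(t)\ne q_j(t)$ for $i\ne j$, $t<T$, such that every limit $L_i=\lim_{t\nearrow T}q_i(t)$ exists. Let $\mathcal G\subset\{1,\dots,n\}$ be a cluster with at least two elements: $L_i=L_j=:L_{\mathcal G}$ for $i,j\in\mathcal G$ and $L_j\neq L_{\mathcal G}$ for $j\notin\mathcal G$. Notation: $M_{\mathcal G}=\sum_{i\in\mathcal G}m_i$, $c_{\mathcal G}=M_{\mathcal G}^{-1}\sum_{i\in\mathcal G}m_iq_i$, $K_{\mathcal G}=\frac12\sum_{i\in\mathcal G}m_i|\dot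 q_i|^2$, $U_{\mathcal G}=\sum_{i<j,\,i,j\in\mathcal G}m_im_j/|q_i-q_j|$, $H_{\mathcal G}=K_{\mathcal G}-U_{\mathcal G}$, $J_{\mathcal G}=\sum_{i\in\mathcal G}m_i|q_i-L_i|^2$, $I^0_{\mathcal G}=\sum_{i\in\mathcal G}m_i|q_i-c_{\mathcal G}|^2$, $r_{\mathcal G}=\sqrt{I^0_{\mathcal G}}$ (all evaluated along $q(t)$). *)

theory Defs
  imports "HOL-Analysis.Analysis"
begin

definition pot :: "(nat \<Rightarrow> real) \<Rightarrow> nat set \<Rightarrow> (nat \<Rightarrow> 'v::real_normed_vector) \<Rightarrow> real" where
  "pot m I x = (\<Sum>(i,j)\<in>{(i,j). i \<in> I \<and> j \<in> I \<and> i < j}. m i * m j / norm (x i - x j))"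

definition kin :: "(nat \<Rightarrow> real) \<Rightarrow> nat set \<Rightarrow> (nat \<Rightarrow> 'v::real_inner) \<Rightarrow> real" where
  "kin m I w = (1/2) * (\<Sum>i\<in>I. m i * (norm (w i))^2)"

definition Jfun :: "(nat \<Rightarrow> real) \<Rightarrow> nat set \<Rightarrow> (nat \<Rightarrow> 'v::real_normed_vector) \<Rightarrow> (nat \<Rightarrow> 'v) \<Rightarrow> real" where
  "Jfun m I L x = (\<Sum>i\<in>I. m i * (norm (x i - L i))^2)"

text \<open>Newtonian force term: (1/m_i) dU/dq_i = sum_{j ~= i} m_j (q_j - q_i)/|q_j - q_i|^3.\<close>
definition accel :: "(nat \<Rightarrow> real) \<Rightarrow> nat \<Rightarrow> (nat \<Rightarrow> 'v::real_normed_vector) \<Rightarrow> nat \<Rightarrow> 'v" where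
  "accel m n x i = (\<Sum>j\<in>{1..n} - {i}. (m j / (norm (x j - x i))^3) *\<^sub>R (x j - x i))"

end

theory Submission
  imports Defs
begin

text \<open>The bodies outside the cluster exert a bounded force on it, so \<open>J\<close> satisfies the
  Lagrange--Jacobi identity \<open>J'' = 2 K + 2 H + e\<close> with \<open>e\<close> bounded, and \<open>\<bar>H'\<bar> \<le> C (1 + K)\<close>.
  If \<open>\<integral> K\<close> diverged, \<open>J'\<close> would become positive, contradicting \<open>J \<rightarrow> 0\<close>; hence \<open>H\<close> converges.
  By Cauchy--Schwarz \<open>J'\<^sup>2 \<le> 8 J K\<close>, so \<open>J'\<^sup>2 / \<surd>J\<close> is decreasing up to a small correction and
  converges; its limit is positive since \<open>U \<ge> c / \<surd>J\<close>. Integrating \<open>(J\<^sup>3\<^sup>/\<^sup>4)'\<close> gives the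
  asymptotics of \<open>J\<close> and \<open>J'\<close>. Those of \<open>U\<close>, and with it of \<open>K\<close> and \<open>J''\<close>, follow
  by a Tauberian argument based on \<open>\<bar>U'\<bar> \<le> B U\<^sup>5\<^sup>/\<^sup>2\<close>.\<close>

section \<open>Real analysis near the collision time\<close>

lemma tendsto_at_left_mono_bounded:
  fixes f :: "real \<Rightarrow> real"
  assumes aT: "a < T"
    and mono: "\<And>s t. a < s \<Longrightarrow> s \<le> t \<Longrightarrow> t < T \<Longrightarrow> f s \<le> f t"
    and bound: "\<And>t. a < t \<Longrightarrow> t < T \<Longrightarrow> f t \<le> B"
  shows "\<exists>l. (f \<longlongrightarrow> l) (at_left T)"
proof
  let ?l = "Sup (f ` {a<..<T})"
  have bdd: "bdd_above (f ` {a<..<T})" using bound by (auto intro!: bdd_aboveI)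
  have ne: "f ` {a<..<T} \<noteq> {}" using aT by auto
  show "(f \<longlongrightarrow> ?l) (at_left T)"
  proof (rule order_tendstoI)
    fix y assume "y < ?l"
    then obtain s where s: "a < s" "s < T" "y < f s"
      using less_cSup_iff[OF ne bdd] by auto
    have "\<forall>t\<in>{s<..<T}. y < f t"
      using s mono[of s] by (auto intro: less_le_trans)
    then show "eventually (\<lambda>t. y < f t) (at_left T)"
      using s by (intro eventually_at_leftI[of s T]) simp_all
  next
    fix y assume y: "?l < y"
    have "f t < y" if "t \<in> {a<..<T}" for t
      using cSup_upper[OF imageI[OF that] bdd] y by (rule le_less_trans)
    then show "eventually (\<lambda>t. f t < y) (at_left T)"
      using aT by (intro eventually_at_leftI[of a T]) simp_all
  qed
qed

lemma mono_of_nonneg_deriv: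
  fixes f :: "real \<Rightarrow> real"
  assumes der: "\<And>t. t \<in> {a<..<b} \<Longrightarrow> (f has_real_derivative f' t) (at t)"
    and nn: "\<And>t. t \<in> {a<..<b} \<Longrightarrow> 0 \<le> f' t"
    and st: "a < s" "s \<le> t" "t < b"
  shows "f s \<le> f t"
proof (rule DERIV_nonneg_imp_nondecreasing[where f = f and a = s and b = t, OF st(2)])
  fix x assume "s \<le> x" "x \<le> t"
  then have "x \<in> {a<..<b}" using st by auto
  then show "\<exists>y. (f has_real_derivative y) (at x) \<and> 0 \<le> y" using der nn by blast
qed

text \<open>Nondecreasing from \<open>s\<close> on, \<open>J\<close> would stay above
  \<open>J s > 0\<close>. Both later contradictions end here: the one bounding the integral of
  \<open>K\<close> and the one giving the sign of \<open>J1\<close>.\<close>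

lemma tendsto_0_not_eventually_increasing:
  fixes J :: "real \<Rightarrow> real"
  assumes "a < s" "s < T"
    and der: "\<And>t. t \<in> {a<..<T} \<Longrightarrow> (J has_real_derivative J1 t) (at t)"
    and lim: "(J \<longlongrightarrow> 0) (at_left T)"
    and pos: "J s > 0"
    and nn: "\<And>t. s \<le> t \<Longrightarrow> t < T \<Longrightarrow> 0 \<le> J1 t"
  shows False
proof -
  have "J s \<le> J t" if t: "t \<in> {s<..<T}" for t
  proof (rule DERIV_nonneg_imp_nondecreasing[where f = J])
    show "s \<le> t" using t by simp
    fix x assume "s \<le> x" "x \<le> t"
    then have "x \<in> {a<..<T}" "0 \<le> J1 x" using t assms(1) nn[of x] by auto
    then show "\<exists>y. (J has_real_derivative y) (at x) \<and> 0 \<le> y" using der by blast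
  qed
  then have "eventually (\<lambda>t. J s \<le> J t) (at_left T)"
    using \<open>s < T\<close> by (intro eventually_at_leftI[of s T]) simp_all
  then have "J s \<le> 0"
    using lim by (intro tendsto_lowerbound[of J 0 "at_left T"]) auto
  then show False using pos by simp
qed

section \<open>Convergence of the energy\<close>

text \<open>By the bound on \<open>H1\<close>, boundedness of \<open>P\<close>, the integral of
  \<open>K\<close>, suffices. A large \<open>P\<close> may lower \<open>H\<close> by about
  \<open>C * P\<close>, and this feeds back into \<open>J''\<close>; on a short enough final
  interval that loss is smaller than the gain \<open>2 * P\<close> which \<open>K\<close>
  contributes to \<open>J1\<close>, so a large \<open>P\<close> would make \<open>J\<close>
  increase.\<close>

lemma energy_tendsto:
  fixes J J1 K H H1 e :: "real \<Rightarrow> real"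
  assumes aT: "a < T"
    and Jpos: "\<And>t. t \<in> {a<..<T} \<Longrightarrow> J t > 0"
    and J': "\<And>t. t \<in> {a<..<T} \<Longrightarrow> (J has_real_derivative J1 t) (at t)"
    and J'': "\<And>t. t \<in> {a<..<T} \<Longrightarrow> (J1 has_real_derivative 2 * K t + 2 * H t + e t) (at t)"
    and H': "\<And>t. t \<in> {a<..<T} \<Longrightarrow> (H has_real_derivative H1 t) (at t)"
    and K0: "\<And>t. t \<in> {a<..<T} \<Longrightarrow> 0 \<le> K t"
    and Kcont: "continuous_on {a<..<T} K"
    and e: "\<And>t. t \<in> {a<..<T} \<Longrightarrow> \<bar>e t\<bar> \<le> C"
    and H1: "\<And>t. t \<in> {a<..<T} \<Longrightarrow> \<bar>H1 t\<bar> \<le> C * (1 + K t)"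
    and lim: "(J \<longlongrightarrow> 0) (at_left T)"
  shows "\<exists>h. (H \<longlongrightarrow> h) (at_left T)"
proof -
  have "(a + T) / 2 \<in> {a<..<T}" using aT by auto
  from e[OF this] have C0: "C \<ge> 0" by linarith
  \<comment> \<open>The final interval is short enough to absorb the feedback; the
    \<open>+ 1\<close> covers \<open>C = 0\<close>. The midpoint keeps \<open>b\<close> above
    \<open>a\<close>, so that \<open>K\<close> is continuous on \<open>{b..t}\<close>.\<close>
  define b where "b = max ((a + T) / 2) (T - 1 / (2 * C + 1))"
  have b: "a < b" "b < T" "2 * C * (T - b) \<le> 1"
  proof -
    have "0 < 1 / (2 * C + 1)" using C0 by simp
    then show "a < b" "b < T" using aT by (auto simp: b_def less_max_iff_disj)
    have "2 * C * (T - b) \<le> 2 * C * (1 / (2 * C + 1))"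
      using C0 by (intro mult_left_mono) (auto simp: b_def)
    also have "\<dots> \<le> 1" using C0 by (simp add: field_simps)
    finally show "2 * C * (T - b) \<le> 1" .
  qed
  define P where "P t = integral {b..t} K" for t
  have P': "(P has_real_derivative K t) (at t)" if t: "t \<in> {b<..<T}" for t
  proof -
    have "t < T" using t by simp
    then obtain u where u: "t < u" "u < T" using dense by blast
    have "continuous_on {b..u} K"
      by (rule continuous_on_subset[OF Kcont]) (use b u in auto)
    from integral_has_real_derivative[OF this, of t] t u
    have "(P has_real_derivative K t) (at t within {b..u})"
      by (simp add: P_def[abs_def])
    moreover have "at t within {b..u} = at t"
      using t u by (intro at_within_interior) auto
    ultimately show ?thesis by simp
  qed
  have P0: "P t \<ge> 0" if "t \<in> {b<..<T}" for t
    unfolding P_def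
  proof (rule integral_nonneg)
    show "K integrable_on {b..t}"
      by (intro integrable_continuous_real continuous_on_subset[OF Kcont]) (use that b in auto)
    show "0 \<le> K x" if "x \<in> {b..t}" for x
      using that \<open>t \<in> {b<..<T}\<close> b K0 by auto
  qed
  have Pmono: "P s \<le> P t" if "b < s" "s \<le> t" "t < T" for s t
    by (rule mono_of_nonneg_deriv[OF P' _ that]) (use K0 b in auto)
  \<comment> \<open>This is the lower estimate of \<open>H\<close> in terms of \<open>P\<close>; the
    matching upper one, \<open>dn\<close>, is needed only after \<open>P\<close> is known to be
    bounded.\<close>
  have up: "H s + C * s + C * P s \<le> H t + C * t + C * P t" if "b < s" "s \<le> t" "t < T" for s t
  proof (rule mono_of_nonneg_deriv[OF _ _ that])
    fix r assume r: "r \<in> {b<..<T}"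
    then have r': "r \<in> {a<..<T}" using b by auto
    show "((\<lambda>t. H t + C * t + C * P t) has_real_derivative H1 r + C * 1 + C * K r) (at r)"
      by (rule derivative_eq_intros P'[OF r] H'[OF r'] refl | simp)+
    show "0 \<le> H1 r + C * 1 + C * K r"
      using H1[OF r'] by (auto simp: algebra_simps)
  qed
  define c where "c = (b + T) / 2"
  have c: "b < c" "c < T" using b by (auto simp: c_def)
  \<comment> \<open>\<open>D\<close> collects all losses that do not involve the later values of
    \<open>P\<close>, so that \<open>J1 s \<ge> P s - D\<close> beyond \<open>c\<close>.\<close>
  define D where "D = \<bar>J1 c\<bar> + 2 * P c + (C + 2 * \<bar>H c\<bar> + 2 * C * (T - c)) * (T - c) + 1"
  have Pbd: "P t \<le> D" if t: "c < t" "t < T" for t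
  proof (rule ccontr)
    assume "\<not> P t \<le> D"
    then have PD: "P t > D" by simp
    have J1ge: "0 \<le> J1 s" if s: "t \<le> s" "s < T" for s
    proof -
      \<comment> \<open>With the endpoint \<open>s\<close> frozen, monotonicity of \<open>P\<close>
        makes \<open>?E\<close> a constant bound for \<open>- (2 * H r + e r)\<close> on all of
        \<open>{c..s}\<close>.\<close>
      let ?E = "C + 2 * \<bar>H c\<bar> + 2 * C * (T - c) + 2 * C * P s"
      have E: "J1 c - 2 * P c + ?E * c \<le> J1 s - 2 * P s + ?E * s"
      proof (rule DERIV_nonneg_imp_nondecreasing[where f = "\<lambda>s'. J1 s' - 2 * P s' + ?E * s'"])
        show "c \<le> s" using s t by simp
        fix r assume r: "c \<le> r" "r \<le> s"
        then have ra: "r \<in> {a<..<T}" and rb: "r \<in> {b<..<T}" using b c s by auto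
        have d: "((\<lambda>s'. J1 s' - 2 * P s' + ?E * s') has_real_derivative
            (2 * K r + 2 * H r + e r) - 2 * K r + ?E * 1) (at r)"
          by (rule derivative_eq_intros P'[OF rb] J''[OF ra] refl | simp)+
        have Hr: "H r \<ge> H c - C * (r - c) - C * (P r - P c)"
          using up[of c r] c r s by (simp add: algebra_simps)
        have "C * (r - c) \<le> C * (T - c)" using C0 r s by (intro mult_left_mono) auto
        moreover have "C * (P r - P c) \<le> C * P s"
          using Pmono[of r s] P0[of c] C0 r s c by (intro mult_left_mono) auto
        ultimately have "H r \<ge> - \<bar>H c\<bar> - C * (T - c) - C * P s" using Hr by linarith
        moreover have "- C \<le> e r" using e[OF ra] by linarith
        ultimately have "0 \<le> (2 * K r + 2 * H r + e r) - 2 * K r + ?E * 1"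
          by (simp add: algebra_simps)
        with d show "\<exists>y. ((\<lambda>s'. J1 s' - 2 * P s' + ?E * s') has_real_derivative y) (at r) \<and> 0 \<le> y"
          by blast
      qed
      have Ps: "P s > D" using Pmono[of t s] PD s t c by auto
      have "?E * (s - c) \<le> ?E * (T - c)"
        using s C0 P0[of s] c t by (intro mult_left_mono) auto
      also have "\<dots> = (C + 2 * \<bar>H c\<bar> + 2 * C * (T - c)) * (T - c) + (2 * C * (T - c)) * P s"
        by (simp add: algebra_simps)
      \<comment> \<open>The choice of \<open>b\<close> enters: the feedback costs at most one of the
        two copies of \<open>P s\<close> gained from \<open>K\<close>.\<close>
      also have "(2 * C * (T - c)) * P s \<le> 1 * P s"
      proof (rule mult_right_mono)
        have "2 * C * (T - c) \<le> 2 * C * (T - b)" using c C0 by (intro mult_left_mono) auto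
        then show "2 * C * (T - c) \<le> 1" using b by linarith
        show "0 \<le> P s" using P0[of s] s t c by auto
      qed
      finally have "?E * (s - c) \<le> (C + 2 * \<bar>H c\<bar> + 2 * C * (T - c)) * (T - c) + P s" by simp
      moreover have "J1 c - 2 * P c + 2 * P s - ?E * (s - c) \<le> J1 s"
        using E by (simp add: algebra_simps)
      ultimately show "0 \<le> J1 s" using Ps unfolding D_def by linarith
    qed
    show False
    proof (rule tendsto_0_not_eventually_increasing[of a t T J J1])
      show "a < t" "t < T" "0 < J t" using t c b Jpos[of t] by auto
    qed (use J' lim J1ge in auto)
  qed
  have "\<exists>l. ((\<lambda>t. P t) \<longlongrightarrow> l) (at_left T)"
    by (rule tendsto_at_left_mono_bounded[OF c(2) _ Pbd]) (use Pmono c in auto)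
  then obtain p where p: "(P \<longlongrightarrow> p) (at_left T)" by blast
  have dn: "H t - C * t - C * P t \<le> H c - C * c - C * P c" if "c < t" "t < T" for t
  proof -
    have "- (H c - C * c - C * P c) \<le> - (H t - C * t - C * P t)"
    proof (rule mono_of_nonneg_deriv[of b T "\<lambda>t. - (H t - C * t - C * P t)"
          "\<lambda>r. - (H1 r - C * 1 - C * K r)"])
      fix r assume r: "r \<in> {b<..<T}"
      then have r': "r \<in> {a<..<T}" using b by auto
      show "((\<lambda>t. - (H t - C * t - C * P t)) has_real_derivative - (H1 r - C * 1 - C * K r)) (at r)"
        by (rule derivative_eq_intros P'[OF r] H'[OF r'] refl | simp)+
      show "0 \<le> - (H1 r - C * 1 - C * K r)"
        using H1[OF r'] by (auto simp: algebra_simps)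
    qed (use that c in auto)
    then show ?thesis by simp
  qed
  \<comment> \<open>The corrected energy is monotone by \<open>up\<close> and bounded by
    \<open>dn\<close> with \<open>Pbd\<close>; since \<open>P\<close> itself converges, the
    correction can be subtracted afterwards.\<close>
  have "\<exists>l. ((\<lambda>t. H t + C * t + C * P t) \<longlongrightarrow> l) (at_left T)"
  proof (rule tendsto_at_left_mono_bounded[OF c(2)])
    show "H s + C * s + C * P s \<le> H t + C * t + C * P t" if "c < s" "s \<le> t" "t < T" for s t
      using up that c by auto
    show "H t + C * t + C * P t \<le> (H c - C * c - C * P c) + 2 * (C * T) + 2 * (C * D)"
      if "c < t" "t < T" for t
    proof -
      have "C * t \<le> C * T" "C * P t \<le> C * D"
        using that C0 Pbd by (auto intro!: mult_left_mono)
      then show ?thesis using dn[OF that] by linarith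
    qed
  qed
  then obtain l where l: "((\<lambda>t. H t + C * t + C * P t) \<longlongrightarrow> l) (at_left T)" by blast
  have "((\<lambda>t. (H t + C * t + C * P t) - C * t - C * P t) \<longlongrightarrow> l - C * T - C * p) (at_left T)"
    by (intro tendsto_intros l p)
  then show ?thesis by auto
qed


section \<open>Asymptotics of \<open>J\<close> and its first derivative\<close>

lemma has_real_derivative_sqrt_comp:
  assumes "(f has_real_derivative f') (at t)" "f t > 0"
  shows "((\<lambda>t. sqrt (f t)) has_real_derivative f' / (2 * sqrt (f t))) (at t)"
  by (rule DERIV_chain2[OF DERIV_real_sqrt assms(1), THEN DERIV_cong])
     (use assms in \<open>auto simp: field_simps\<close>)

text \<open>Only one-sided bounds on \<open>J2\<close> enter. Once
  \<open>S = J1\<^sup>2 / sqrt J\<close> has a positive limit, the derivative of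
  \<open>J powr (3/4)\<close> is \<open>-3/4 * sqrt S\<close> and converges too, so l'Hopital's rule
  gives the rate. The constant is \<open>A = \<kappa> powr (4/3)\<close> with
  \<open>\<kappa> = 3/4 * sqrt \<sigma>\<close>.\<close>

lemma sundman_asymptotics:
  fixes J J1 J2 K U :: "real \<Rightarrow> real"
  assumes aT: "a < T"
    and Jpos: "\<And>t. t \<in> {a<..<T} \<Longrightarrow> J t > 0"
    and J': "\<And>t. t \<in> {a<..<T} \<Longrightarrow> (J has_real_derivative J1 t) (at t)"
    and J'': "\<And>t. t \<in> {a<..<T} \<Longrightarrow> (J1 has_real_derivative J2 t) (at t)"
    and JK: "\<And>t. t \<in> {a<..<T} \<Longrightarrow> 2 * K t - C \<le> J2 t"
    and JU: "\<And>t. t \<in> {a<..<T} \<Longrightarrow> 2 * U t - C \<le> J2 t"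
    and CS: "\<And>t. t \<in> {a<..<T} \<Longrightarrow> (J1 t)\<^sup>2 \<le> 8 * J t * K t"
    and c: "c > 0" and C0: "C \<ge> 0"
    and Uge: "\<And>t. t \<in> {a<..<T} \<Longrightarrow> c / sqrt (J t) \<le> U t"
    and lim: "(J \<longlongrightarrow> 0) (at_left T)"
  shows "\<exists>A>0. ((\<lambda>t. J t / (T - t) powr (4/3)) \<longlongrightarrow> A) (at_left T) \<and>
               ((\<lambda>t. J1 t / (T - t) powr (1/3)) \<longlongrightarrow> - 4 * A / 3) (at_left T)"
proof -
  define r where "r t = sqrt (J t)" for t
  have rlim: "(r \<longlongrightarrow> 0) (at_left T)"
    using tendsto_real_sqrt[OF lim] by (simp add: r_def[abs_def])
  have "((\<lambda>t. C * r t) \<longlongrightarrow> C * 0) (at_left T)"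
    by (intro tendsto_intros rlim)
  then have "eventually (\<lambda>t. C * r t < c) (at_left T)"
    using order_tendstoD(2)[of "\<lambda>t. C * r t" 0 "at_left T" c] c by simp
  then obtain b0 where b0: "b0 < T" "\<And>t. b0 < t \<Longrightarrow> t < T \<Longrightarrow> C * r t < c"
    unfolding eventually_at_left_field by auto
  define b where "b = max a b0"
  have b: "a \<le> b" "b < T" "\<And>t. t \<in> {b<..<T} \<Longrightarrow> C * r t < c"
    using b0 aT by (auto simp: b_def)
  have ab: "t \<in> {a<..<T}" if "t \<in> {b<..<T}" for t using that b by auto
  have rpos: "r t > 0" if "t \<in> {b<..<T}" for t using Jpos[OF ab[OF that]] by (simp add: r_def)
  have r2: "J t = (r t)\<^sup>2" if "t \<in> {b<..<T}" for t
    using Jpos[OF ab[OF that]] by (simp add: r_def)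
  have r': "(r has_real_derivative J1 t / (2 * r t)) (at t)" if "t \<in> {b<..<T}" for t
    unfolding r_def[abs_def]
    by (rule has_real_derivative_sqrt_comp[OF J'[OF ab[OF that]] Jpos[OF ab[OF that]]])
  \<comment> \<open>After \<open>b\<close> the error \<open>C\<close> is below
    \<open>c / r t\<close>, so it uses up only half of the lower bound \<open>2 * c / r t\<close>
    for \<open>2 * U t\<close>.\<close>
  have J2ge: "c / r t \<le> J2 t" if t: "t \<in> {b<..<T}" for t
  proof -
    have "c / r t \<ge> C" using b(3)[OF t] rpos[OF t] by (simp add: field_simps)
    moreover have "2 * (c / r t) - C \<le> J2 t"
      using Uge[OF ab[OF t]] JU[OF ab[OF t]] by (simp add: r_def)
    ultimately show ?thesis by linarith
  qed
  have J2pos: "J2 t > 0" if "t \<in> {b<..<T}" for t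
    using J2ge[OF that] rpos[OF that] c by (meson divide_pos_pos less_le_trans)
  \<comment> \<open>\<open>J1\<close> is increasing because \<open>J2 > 0\<close>, so a nonnegative
    value would persist up to \<open>T\<close> and prevent \<open>J\<close> from tending to
    0.\<close>
  have J1neg: "J1 s < 0" if s: "s \<in> {b<..<T}" for s
  proof (rule ccontr)
    assume "\<not> J1 s < 0"
    have nn: "0 \<le> J1 t" if t: "s \<le> t" "t < T" for t
    proof -
      have "J1 s \<le> J1 t"
        by (rule mono_of_nonneg_deriv[where f = J1 and f' = J2 and a = b and b = T])
           (use s t ab J'' J2pos in \<open>auto simp: less_imp_le\<close>)
      with \<open>\<not> J1 s < 0\<close> show ?thesis by simp
    qed
    show False
    proof (rule tendsto_0_not_eventually_increasing[of a s T J J1])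
      show "a < s" "s < T" "0 < J s" using s ab[OF s] Jpos by auto
    qed (use J' lim nn in auto)
  qed
  \<comment> \<open>Sundman's monotone quantity: \<open>J'\<^sup>2 / \<surd>J\<close> is decreasing up to a multiple of \<open>\<surd>J\<close>,
      because \<open>J'' - J'\<^sup>2 / (4 J) \<ge> J'' - 2 K\<close> by Cauchy--Schwarz.\<close>
  define S where "S t = (J1 t)\<^sup>2 / r t" for t
  have S': "((\<lambda>t. - (S t + 4 * C * r t)) has_real_derivative
      - (J1 t / r t * (2 * J2 t - (J1 t)\<^sup>2 / (2 * J t) + 2 * C))) (at t)"
    if t: "t \<in> {b<..<T}" for t
    unfolding S_def[abs_def] using rpos[OF t]
    by (auto intro!: derivative_eq_intros J''[OF ab[OF t]] r'[OF t]
             simp: r2[OF t] field_simps power2_eq_square power3_eq_cube)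
  have S'nn: "0 \<le> - (J1 t / r t * (2 * J2 t - (J1 t)\<^sup>2 / (2 * J t) + 2 * C))"
    if t: "t \<in> {b<..<T}" for t
  proof -
    have "(J1 t)\<^sup>2 / (2 * J t) \<le> 4 * K t"
      using CS[OF ab[OF t]] Jpos[OF ab[OF t]] by (simp add: field_simps)
    then have "0 \<le> 2 * J2 t - (J1 t)\<^sup>2 / (2 * J t) + 2 * C"
      using JK[OF ab[OF t]] by linarith
    moreover have "J1 t / r t \<le> 0"
      using J1neg[OF t] rpos[OF t] by (simp add: divide_le_0_iff)
    ultimately show ?thesis by (metis mult_nonpos_nonneg neg_0_le_iff_le)
  qed
  have "\<exists>l. ((\<lambda>t. - (S t + 4 * C * r t)) \<longlongrightarrow> l) (at_left T)"
  proof (rule tendsto_at_left_mono_bounded[OF b(2)])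
    show "- (S s + 4 * C * r s) \<le> - (S t + 4 * C * r t)" if "b < s" "s \<le> t" "t < T" for s t
      by (rule mono_of_nonneg_deriv[where f = "\<lambda>t. - (S t + 4 * C * r t)" and a = b and b = T,
            OF S' S'nn that])
    show "- (S t + 4 * C * r t) \<le> 0" if "b < t" "t < T" for t
    proof -
      have "0 \<le> S t" "0 \<le> C * r t" using rpos[of t] C0 that by (simp_all add: S_def)
      then show ?thesis by linarith
    qed
  qed
  then obtain l where l: "((\<lambda>t. - (S t + 4 * C * r t)) \<longlongrightarrow> l) (at_left T)" by blast
  have "((\<lambda>t. - (- (S t + 4 * C * r t)) - 4 * C * r t) \<longlongrightarrow> - l - 4 * C * 0) (at_left T)"
    by (intro tendsto_intros l rlim)
  then have Slim: "(S \<longlongrightarrow> - l) (at_left T)" by simp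
  have evb: "eventually (\<lambda>t. t \<in> {b<..<T}) (at_left T)"
    using b(2) by (intro eventually_at_leftI[of b T]) simp_all
  define \<sigma> where "\<sigma> = - l"
  have Slim: "(S \<longlongrightarrow> \<sigma>) (at_left T)" using Slim by (simp add: \<sigma>_def)
  \<comment> \<open>This comparison function keeps the limit of \<open>S\<close> away from 0. Its
    derivative is a product of two nonpositive factors and \<open>f\<close> tends to 0, hence
    \<open>f \<le> 0\<close>, which says \<open>S \<ge> 4 * c\<close>.\<close>
  define f where "f t = 4 * c * r t - (J1 t)\<^sup>2" for t
  have "((\<lambda>t. 4 * c * r t - S t * r t) \<longlongrightarrow> 4 * c * 0 - \<sigma> * 0) (at_left T)"
    by (intro tendsto_intros rlim Slim)
  then have "((\<lambda>t. 4 * c * r t - S t * r t) \<longlongrightarrow> 0) (at_left T)" by simp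
  moreover have ev: "eventually (\<lambda>t. 4 * c * r t - S t * r t = f t) (at_left T)"
    using evb
  proof eventually_elim
    case (elim t)
    then show ?case using rpos[OF elim] by (simp add: S_def f_def)
  qed
  ultimately have flim: "(f \<longlongrightarrow> 0) (at_left T)"
    using tendsto_cong[OF ev] by simp
  have f': "(f has_real_derivative 2 * J1 t * (c / r t - J2 t)) (at t)" if t: "t \<in> {b<..<T}" for t
    unfolding f_def[abs_def] using rpos[OF t]
    by (auto intro!: derivative_eq_intros J''[OF ab[OF t]] r'[OF t] simp: field_simps)
  have f'nn: "0 \<le> 2 * J1 t * (c / r t - J2 t)" if t: "t \<in> {b<..<T}" for t
    using J1neg[OF t] J2ge[OF t] by (simp add: mult_nonpos_nonpos)
  have f_le: "f s \<le> 0" if s: "s \<in> {b<..<T}" for s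
  proof (rule tendsto_lowerbound[OF flim])
    have "\<forall>t\<in>{s<..<T}. f s \<le> f t"
      using s by (auto intro!: mono_of_nonneg_deriv[OF f' f'nn])
    then show "eventually (\<lambda>t. f s \<le> f t) (at_left T)"
      using s by (intro eventually_at_leftI[of s T]) simp_all
  qed simp
  have "eventually (\<lambda>t. 4 * c \<le> S t) (at_left T)"
    using evb
  proof eventually_elim
    case (elim t)
    then show ?case using f_le[OF elim] rpos[OF elim] by (simp add: S_def f_def field_simps)
  qed
  from tendsto_lowerbound[OF Slim this] have "4 * c \<le> \<sigma>" by simp
  then have \<sigma>: "\<sigma> > 0" using c by linarith
  have rootS: "J1 t * J t powr (-1/4) = - sqrt (S t)" if t: "t \<in> {b<..<T}" for t
  proof -
    have "(J t powr (-1/4))\<^sup>2 = J t powr (- (1/2))"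
      by (simp add: powr_add[symmetric] power2_eq_square)
    also have "\<dots> = 1 / r t"
      using Jpos[OF ab[OF t]] by (simp add: r_def powr_minus_divide powr_half_sqrt)
    finally have "S t = (J1 t * J t powr (-1/4))\<^sup>2"
      by (simp add: S_def power_mult_distrib)
    moreover have "J1 t * J t powr (-1/4) \<le> 0"
      using J1neg[OF t] by (simp add: mult_nonpos_nonneg)
    ultimately show ?thesis by simp
  qed
  \<comment> \<open>With the exponent 3/4, \<open>J1\<close> enters the derivative only through
    \<open>J1 * J powr (-1/4)\<close>, which by \<open>rootS\<close> is a function of
    \<open>S\<close> alone; \<open>J1 < 0\<close> selects the negative root.\<close>
  define g where "g t = J t powr (3/4)" for t
  have g': "(g has_real_derivative 3/4 * - sqrt (S t)) (at t)" if t: "t \<in> {b<..<T}" for t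
  proof -
    have "(g has_real_derivative 3/4 * (J1 t * J t powr (-1/4))) (at t)"
      using DERIV_fun_powr[OF J'[OF ab[OF t]] Jpos[OF ab[OF t]], of "3/4"]
      by (simp add: g_def[abs_def] mult_ac)
    then show ?thesis by (simp only: rootS[OF t])
  qed
  have gpos: "g t > 0" if "t \<in> {b<..<T}" for t
    using Jpos[OF ab[OF that]] by (simp add: g_def)
  define \<kappa> where "\<kappa> = 3/4 * sqrt \<sigma>"
  have \<kappa>: "\<kappa> > 0" using \<sigma> by (simp add: \<kappa>_def)
  have glim: "((\<lambda>t. g t / (T - t)) \<longlongrightarrow> \<kappa>) (at_left T)"
  proof (rule lhopital_left[where f' = "\<lambda>t. 3/4 * - sqrt (S t)" and g' = "\<lambda>t. -1"])
    have "((\<lambda>t. J t powr (3/4)) \<longlongrightarrow> 0) (at_left T)"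
    proof (rule tendsto_zero_powrI[OF lim tendsto_const])
      show "eventually (\<lambda>t. 0 \<le> J t) (at_left T)"
        using evb by eventually_elim (use Jpos ab in \<open>auto simp: less_imp_le\<close>)
    qed simp
    then show "(g \<longlongrightarrow> 0) (at_left T)" by (simp add: g_def[abs_def])
    have "((\<lambda>t. T - t) \<longlongrightarrow> T - T) (at_left T)" by (intro tendsto_intros)
    then show "((\<lambda>t. T - t) \<longlongrightarrow> 0) (at_left T)" by simp
    show "eventually (\<lambda>t. T - t \<noteq> 0) (at_left T)"
      using evb by eventually_elim simp
    show "eventually (\<lambda>t. (g has_real_derivative 3/4 * - sqrt (S t)) (at t)) (at_left T)"
      using evb by eventually_elim (rule g')
    show "eventually (\<lambda>t. ((\<lambda>t. T - t) has_real_derivative -1) (at t)) (at_left T)"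
      by (auto intro!: always_eventually derivative_eq_intros)
    have "((\<lambda>t. 3/4 * - sqrt (S t) / -1) \<longlongrightarrow> 3/4 * - sqrt \<sigma> / -1) (at_left T)"
      by (intro tendsto_intros Slim) simp
    then show "((\<lambda>t. 3/4 * - sqrt (S t) / -1) \<longlongrightarrow> \<kappa>) (at_left T)" by (simp add: \<kappa>_def)
  qed simp
  have "((\<lambda>t. (g t / (T - t)) powr (4/3)) \<longlongrightarrow> \<kappa> powr (4/3)) (at_left T)"
    using \<kappa> by (intro tendsto_intros glim) simp
  moreover have "eventually (\<lambda>t. (g t / (T - t)) powr (4/3) = J t / (T - t) powr (4/3)) (at_left T)"
    using evb
  proof eventually_elim
    case (elim t)
    then show ?case using Jpos[OF ab[OF elim]] by (simp add: g_def powr_divide powr_powr)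
  qed
  ultimately have A: "((\<lambda>t. J t / (T - t) powr (4/3)) \<longlongrightarrow> \<kappa> powr (4/3)) (at_left T)"
    using tendsto_cong by fast
  \<comment> \<open>No differentiation of the asymptotics of \<open>J\<close> is needed:
    \<open>J1 = - sqrt S * J powr (1/4)\<close>, and \<open>J powr (1/4)\<close> is
    \<open>g powr (1/3)\<close>.\<close>
  have "((\<lambda>t. - sqrt (S t) * (g t / (T - t)) powr (1/3)) \<longlongrightarrow> - sqrt \<sigma> * \<kappa> powr (1/3)) (at_left T)"
    using \<kappa> by (intro tendsto_intros glim Slim) simp
  moreover have "eventually (\<lambda>t. - sqrt (S t) * (g t / (T - t)) powr (1/3)
      = J1 t / (T - t) powr (1/3)) (at_left T)"
    using evb
  proof eventually_elim
    case (elim t)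
    have "(g t / (T - t)) powr (1/3) = J t powr (1/4) / (T - t) powr (1/3)"
      using elim by (simp add: g_def powr_divide powr_powr)
    moreover have "J t powr (-1/4) * J t powr (1/4) = 1"
      using Jpos[OF ab[OF elim]] by (simp add: powr_add[symmetric])
    ultimately show ?case by (simp add: rootS[OF elim, symmetric] mult.assoc)
  qed
  ultimately have "((\<lambda>t. J1 t / (T - t) powr (1/3)) \<longlongrightarrow> - sqrt \<sigma> * \<kappa> powr (1/3)) (at_left T)"
    using tendsto_cong by fast
  moreover have "- sqrt \<sigma> * \<kappa> powr (1/3) = - 4 * (\<kappa> powr (4/3)) / 3"
  proof -
    have "\<kappa> powr (4/3) = \<kappa> powr (1 + 1/3)" by simp
    also have "\<dots> = \<kappa> * \<kappa> powr (1/3)" using \<kappa> unfolding powr_add by simp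
    finally show ?thesis by (simp add: \<kappa>_def)
  qed
  ultimately have "((\<lambda>t. J1 t / (T - t) powr (1/3)) \<longlongrightarrow> - 4 * (\<kappa> powr (4/3)) / 3) (at_left T)"
    by (simp only:)
  then show ?thesis using A \<kappa> by (intro exI[of _ "\<kappa> powr (4/3)"] conjI) simp_all
qed


section \<open>Asymptotics of the potential\<close>

text \<open>A Tauberian argument: \<open>u = U\<^sup>-\<^sup>3\<^sup>/\<^sup>2\<close> is Lipschitz, so for \<open>l > 1\<close> its values at \<open>t\<close> and at the
  mean value point \<open>\<xi>\<close> of \<open>J1\<close> between \<open>T - l (T - t)\<close> and \<open>t\<close> differ by at most
  \<open>D (l - 1) (T - t)\<close>, while the asymptotics of \<open>J1\<close> determines \<open>U\<close> at \<open>\<xi>\<close>; then let \<open>l \<rightarrow> 1\<close>.\<close>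

lemma potential_asymptotics:
  fixes J1 J2 U U1 :: "real \<Rightarrow> real"
  assumes aT: "a < T"
    and J'': "\<And>t. t \<in> {a<..<T} \<Longrightarrow> (J1 has_real_derivative J2 t) (at t)"
    and JU: "\<And>t. t \<in> {a<..<T} \<Longrightarrow> \<bar>J2 t - 2 * U t\<bar> \<le> C"
    and Upos: "\<And>t. t \<in> {a<..<T} \<Longrightarrow> U t > 0"
    and U': "\<And>t. t \<in> {a<..<T} \<Longrightarrow> (U has_real_derivative U1 t) (at t)"
    and U1: "\<And>t. t \<in> {a<..<T} \<Longrightarrow> \<bar>U1 t\<bar> \<le> B * U t powr (5/2)"
    and k: "k > 0"
    and lim: "((\<lambda>t. J1 t / (T - t) powr (1/3)) \<longlongrightarrow> - k) (at_left T)"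
  shows "((\<lambda>t. U t / (T - t) powr (-2/3)) \<longlongrightarrow> k / 6) (at_left T)"
proof -
  \<comment> \<open>The chain rule produces the factor \<open>U powr (-5/2)\<close>, which exactly
    cancels the growth allowed to \<open>U1\<close>.\<close>
  define u where "u t = U t powr (-3/2)" for t
  define D where "D = 3/2 * \<bar>B\<bar>"
  have u': "(u has_real_derivative -3/2 * (U t powr (-5/2) * U1 t)) (at t)"
    if t: "t \<in> {a<..<T}" for t
    using DERIV_fun_powr[OF U'[OF t] Upos[OF t], of "-3/2"] by (simp add: u_def[abs_def] mult_ac)
  have u'bd: "\<bar>-3/2 * (U t powr (-5/2) * U1 t)\<bar> \<le> D" if t: "t \<in> {a<..<T}" for t
  proof -
    have "U t powr (-5/2) * \<bar>U1 t\<bar> \<le> U t powr (-5/2) * (\<bar>B\<bar> * U t powr (5/2))"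
    proof (rule mult_left_mono)
      have "B * U t powr (5/2) \<le> \<bar>B\<bar> * U t powr (5/2)" by (intro mult_right_mono) auto
      then show "\<bar>U1 t\<bar> \<le> \<bar>B\<bar> * U t powr (5/2)" using U1[OF t] by linarith
    qed simp
    also have "\<dots> = \<bar>B\<bar> * (U t powr (-5/2) * U t powr (5/2))" by simp
    also have "U t powr (-5/2) * U t powr (5/2) = 1"
      using Upos[OF t] by (simp add: powr_add[symmetric])
    finally show ?thesis by (simp add: D_def abs_mult mult.commute)
  qed
  have Lip: "\<bar>u t - u s\<bar> \<le> D * (t - s)" if st: "a < s" "s < t" "t < T" for s t
  proof -
    obtain z where z: "s < z" "z < t" "u t - u s = (t - s) * (-3/2 * (U z powr (-5/2) * U1 z))"
      using MVT2[OF st(2), of u "\<lambda>z. -3/2 * (U z powr (-5/2) * U1 z)"] u' st by force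
    have "\<bar>u t - u s\<bar> = (t - s) * \<bar>-3/2 * (U z powr (-5/2) * U1 z)\<bar>"
      unfolding z(3) abs_mult using st by simp
    also have "\<dots> \<le> (t - s) * D"
      using u'bd[of z] z st by (intro mult_left_mono) auto
    finally show ?thesis by (simp add: mult.commute)
  qed
  \<comment> \<open>\<open>p l\<close> is the limit of the mean of \<open>J2\<close> over
    \<open>{w t..t}\<close>, rescaled by \<open>(T - t) powr (2/3)\<close>. It is \<open>k\<close>
    times a difference quotient of the cube root at 1, so it tends to \<open>k / 3\<close> as
    \<open>l\<close> tends to 1.\<close>
  define p where "p l = k * (l powr (1/3) - 1) / (l - 1)" for l
  have main: "eventually (\<lambda>t. \<bar>u t / (T - t) - (p l / 2) powr (-3/2)\<bar> \<le> (D + 1) * (l - 1)) (at_left T)"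
    if l: "l > 1" for l
  proof -
    \<comment> \<open>The left endpoint scales with the distance to \<open>T\<close>, so the
      normalised values of \<open>J1\<close> at \<open>w t\<close> and at \<open>t\<close> have the
      same limit and differ in scale by the fixed factor \<open>l powr (1/3)\<close>.\<close>
    define w where "w t = T - l * (T - t)" for t
    have wT: "T - w t = l * (T - t)" for t by (simp add: w_def)
    define b where "b = T - (T - a) / l"
    have "(T - a) / l < (T - a) / 1" using aT l by (intro divide_strict_left_mono) auto
    then have b: "b < T" "a < b" using aT l by (auto simp: b_def)
    have w: "a < w t" "w t < t" "t < T" if "t \<in> {b<..<T}" for t
    proof -
      have "l * (T - t) < T - a" using that l by (simp add: b_def field_simps)
      then show "a < w t" by (simp add: w_def)
      have "1 * (T - t) < l * (T - t)" using that l by (intro mult_strict_right_mono) auto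
      then show "w t < t" by (simp add: w_def)
    qed (use that in auto)
    \<comment> \<open>The guard makes the claim hold for every \<open>t\<close>, so that the mean
      value points can be chosen as one function \<open>\<xi>\<close>.\<close>
    have "\<exists>z. t \<in> {b<..<T} \<longrightarrow> w t < z \<and> z < t \<and> J1 t - J1 (w t) = (t - w t) * J2 z" for t
    proof (cases "t \<in> {b<..<T}")
      case True
      have "\<exists>z>w t. z < t \<and> J1 t - J1 (w t) = (t - w t) * J2 z"
        by (rule MVT2) (use w[OF True] J'' in auto)
      then show ?thesis by blast
    qed blast
    then obtain \<xi> where \<xi>: "\<And>t. t \<in> {b<..<T} \<Longrightarrow> w t < \<xi> t"
        "\<And>t. t \<in> {b<..<T} \<Longrightarrow> \<xi> t < t"
        "\<And>t. t \<in> {b<..<T} \<Longrightarrow> J1 t - J1 (w t) = (t - w t) * J2 (\<xi> t)"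
      by metis
    have evb: "eventually (\<lambda>t. t \<in> {b<..<T}) (at_left T)"
      using b by (intro eventually_at_leftI[of b T]) simp_all
    have \<xi>a: "\<xi> t \<in> {a<..<T}" if "t \<in> {b<..<T}" for t
      using \<xi>(1,2)[OF that] w[OF that] by auto
    have "(w \<longlongrightarrow> T - l * (T - T)) (at_left T)"
      unfolding w_def[abs_def] by (intro tendsto_intros)
    then have wlim: "filterlim w (at_left T) (at_left T)"
      by (intro tendsto_imp_filterlim_at_left eventually_mono[OF evb]) (use w in force)+
    have "((\<lambda>t. J1 (w t) / (T - w t) powr (1/3)) \<longlongrightarrow> - k) (at_left T)"
      by (rule filterlim_compose[OF lim wlim])
    then have "((\<lambda>t. (J1 t / (T - t) powr (1/3) - J1 (w t) / (T - w t) powr (1/3) * l powr (1/3)) / (l - 1))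
        \<longlongrightarrow> (- k - (- k) * l powr (1/3)) / (l - 1)) (at_left T)"
      using l by (intro tendsto_intros lim) auto
    moreover have evJ: "eventually (\<lambda>t. (J1 t / (T - t) powr (1/3) - J1 (w t) / (T - w t) powr (1/3) * l powr (1/3)) / (l - 1)
        = J2 (\<xi> t) * (T - t) powr (2/3)) (at_left T)"
      using evb
    proof eventually_elim
      case (elim t)
      have q: "(T - w t) powr (1/3) = l powr (1/3) * (T - t) powr (1/3)"
        using l elim unfolding wT by (simp add: powr_mult)
      have "(J1 t / (T - t) powr (1/3) - J1 (w t) / (T - w t) powr (1/3) * l powr (1/3))
          = (J1 t - J1 (w t)) / (T - t) powr (1/3)"
        unfolding q using l by (simp add: diff_divide_distrib)
      also have "J1 t - J1 (w t) = (l - 1) * (T - t) * J2 (\<xi> t)"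
        using \<xi>(3)[OF elim] by (simp add: w_def algebra_simps)
      also have "\<dots> / (T - t) powr (1/3) = (l - 1) * J2 (\<xi> t) * ((T - t) powr 1 / (T - t) powr (1/3))"
        using elim by simp
      also have "(T - t) powr 1 / (T - t) powr (1/3) = (T - t) powr (2/3)"
        unfolding powr_diff[symmetric] by simp
      finally show ?case using l by simp
    qed
    moreover have "(- k - (- k) * l powr (1/3)) / (l - 1) = p l"
      by (simp add: p_def algebra_simps)
    ultimately have J2lim: "((\<lambda>t. J2 (\<xi> t) * (T - t) powr (2/3)) \<longlongrightarrow> p l) (at_left T)"
      using tendsto_cong[OF evJ] by simp
    have "l powr (1/3) > 1 powr (1/3)" using l by (intro powr_less_mono2) auto
    then have pl: "p l > 0" using l k by (simp add: p_def)
    have tau: "((\<lambda>t. T - t) \<longlongrightarrow> 0) (at_left T)"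
      using tendsto_diff[OF tendsto_const[of T] tendsto_ident_at[of T "{..<T}"]] by simp
    have tau23: "((\<lambda>t. (T - t) powr (2/3)) \<longlongrightarrow> 0) (at_left T)"
      by (rule tendsto_zero_powrI[OF tau tendsto_const])
         (use evb in \<open>auto elim!: eventually_mono\<close>)
    have "((\<lambda>t. (J2 (\<xi> t) - 2 * U (\<xi> t)) * (T - t) powr (2/3)) \<longlongrightarrow> 0) (at_left T)"
    proof (rule tendsto_0_le[OF tau23])
      show "eventually (\<lambda>t. norm ((J2 (\<xi> t) - 2 * U (\<xi> t)) * (T - t) powr (2/3))
          \<le> norm ((T - t) powr (2/3)) * C) (at_left T)"
        using evb
      proof eventually_elim
        case (elim t)
        then show ?case using JU[OF \<xi>a[OF elim]] by (simp add: abs_mult mult.commute mult_right_mono)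
      qed
    qed
    then have "((\<lambda>t. (J2 (\<xi> t) * (T - t) powr (2/3) - (J2 (\<xi> t) - 2 * U (\<xi> t)) * (T - t) powr (2/3)) / 2)
        \<longlongrightarrow> (p l - 0) / 2) (at_left T)"
      by (intro tendsto_intros J2lim) simp_all
    then have "((\<lambda>t. U (\<xi> t) * (T - t) powr (2/3)) \<longlongrightarrow> p l / 2) (at_left T)"
      by (simp add: algebra_simps)
    then have "((\<lambda>t. (U (\<xi> t) * (T - t) powr (2/3)) powr (-3/2)) \<longlongrightarrow> (p l / 2) powr (-3/2)) (at_left T)"
      using pl by (intro tendsto_intros) simp_all
    moreover have ev: "eventually (\<lambda>t. (U (\<xi> t) * (T - t) powr (2/3)) powr (-3/2) = u (\<xi> t) / (T - t)) (at_left T)"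
      using evb
    proof eventually_elim
      case (elim t)
      have "(U (\<xi> t) * (T - t) powr (2/3)) powr (-3/2) = u (\<xi> t) * (T - t) powr (-1)"
        using Upos[OF \<xi>a[OF elim]] by (simp add: u_def powr_mult powr_powr)
      then show ?case using elim by (simp add: powr_minus_divide)
    qed
    ultimately have "((\<lambda>t. u (\<xi> t) / (T - t)) \<longlongrightarrow> (p l / 2) powr (-3/2)) (at_left T)"
      using tendsto_cong[OF ev] by simp
    \<comment> \<open>The tolerance \<open>l - 1\<close> is added to the Lipschitz error
      \<open>D * (l - 1)\<close>, whence the factor \<open>D + 1\<close> in
      \<open>main\<close>.\<close>
    from tendstoD[OF this, of "l - 1"] l
    have "eventually (\<lambda>t. dist (u (\<xi> t) / (T - t)) ((p l / 2) powr (-3/2)) < l - 1) (at_left T)"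
      by simp
    then show ?thesis using evb
    proof eventually_elim
      case (elim t)
      have "\<bar>u t - u (\<xi> t)\<bar> \<le> D * (t - \<xi> t)"
        using Lip[of "\<xi> t" t] \<xi>a[OF elim(2)] \<xi>(2)[OF elim(2)] elim(2) by auto
      also have "\<dots> \<le> D * ((l - 1) * (T - t))"
        using \<xi>(1)[OF elim(2)] by (intro mult_left_mono) (auto simp: D_def w_def algebra_simps)
      finally have "\<bar>u t / (T - t) - u (\<xi> t) / (T - t)\<bar> \<le> D * (l - 1)"
        using elim(2) by (simp add: diff_divide_distrib[symmetric] field_simps)
      then have "dist (u t / (T - t)) (u (\<xi> t) / (T - t)) \<le> D * (l - 1)"
        by (simp add: dist_real_def)
      moreover have "dist (u t / (T - t)) ((p l / 2) powr (-3/2))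
          \<le> dist (u t / (T - t)) (u (\<xi> t) / (T - t)) + dist (u (\<xi> t) / (T - t)) ((p l / 2) powr (-3/2))"
        by (rule dist_triangle)
      ultimately have "dist (u t / (T - t)) ((p l / 2) powr (-3/2)) \<le> D * (l - 1) + (l - 1)"
        using elim(1) by linarith
      then show ?case by (simp add: dist_real_def distrib_right)
    qed
  qed
  have "((\<lambda>l. k * ((l powr (1/3) - 1) / (l - 1))) \<longlongrightarrow> k * (1/3)) (at_right 1)"
  proof (rule tendsto_mult_left)
    have "((\<lambda>l::real. l powr (1/3)) has_real_derivative 1/3) (at 1)"
      by (auto intro!: derivative_eq_intros)
    then have "((\<lambda>l::real. (l powr (1/3) - 1) / (l - 1)) \<longlongrightarrow> 1/3) (at 1)"
      by (simp add: has_field_derivative_iff)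
    then show "((\<lambda>l::real. (l powr (1/3) - 1) / (l - 1)) \<longlongrightarrow> 1/3) (at_right 1)"
      by (rule tendsto_mono[rotated]) (simp add: at_le)
  qed
  then have "(p \<longlongrightarrow> k / 3) (at_right 1)" by (simp add: p_def[abs_def])
  then have pl: "((\<lambda>l. (p l / 2) powr (-3/2)) \<longlongrightarrow> (k / 3 / 2) powr (-3/2)) (at_right 1)"
    using k by (intro tendsto_intros) simp_all
  \<comment> \<open>The order of the limits matters: first \<open>l\<close> is fixed close to 1
    according to \<open>e\<close>, and only then does \<open>t\<close> approach
    \<open>T\<close>.\<close>
  have ulim: "((\<lambda>t. u t / (T - t)) \<longlongrightarrow> (k / 6) powr (-3/2)) (at_left T)"
  proof (rule tendstoI)
    fix e :: real assume e: "e > 0"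
    have "eventually (\<lambda>l. dist ((p l / 2) powr (-3/2)) ((k / 6) powr (-3/2)) < e / 2) (at_right 1)"
      using tendstoD[OF pl, of "e / 2"] e by simp
    moreover have "((\<lambda>l. (D + 1) * (l - 1)) \<longlongrightarrow> (D + 1) * (1 - 1)) (at_right 1)"
      by (intro tendsto_intros)
    then have "eventually (\<lambda>l. (D + 1) * (l - 1) < e / 2) (at_right 1)"
      using order_tendstoD(2)[of "\<lambda>l. (D + 1) * (l - 1)" 0 "at_right 1" "e / 2"] e by simp
    moreover have "eventually (\<lambda>l::real. l > 1) (at_right 1)"
      by (rule eventually_at_right_less)
    ultimately have "eventually (\<lambda>l. dist ((p l / 2) powr (-3/2)) ((k / 6) powr (-3/2)) < e / 2 \<and>
        (D + 1) * (l - 1) < e / 2 \<and> l > 1) (at_right 1)"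
      by eventually_elim simp
    then obtain l where l: "dist ((p l / 2) powr (-3/2)) ((k / 6) powr (-3/2)) < e / 2"
        "(D + 1) * (l - 1) < e / 2" "l > 1"
      using eventually_happens'[OF trivial_limit_at_right_real] by blast
    show "eventually (\<lambda>t. dist (u t / (T - t)) ((k / 6) powr (-3/2)) < e) (at_left T)"
      using main[OF l(3)]
    proof eventually_elim
      case (elim t)
      then have "dist (u t / (T - t)) ((p l / 2) powr (-3/2)) \<le> (D + 1) * (l - 1)"
        by (simp only: dist_real_def)
      then show ?case
        using l dist_triangle[of "u t / (T - t)" "(k / 6) powr (-3/2)" "(p l / 2) powr (-3/2)"]
        by linarith
    qed
  qed
  have "((\<lambda>t. (u t / (T - t)) powr (-2/3)) \<longlongrightarrow> ((k / 6) powr (-3/2)) powr (-2/3)) (at_left T)"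
    using k by (intro tendsto_intros ulim) simp_all
  moreover have eva: "eventually (\<lambda>t. t \<in> {a<..<T}) (at_left T)"
    using aT by (intro eventually_at_leftI[of a T]) simp_all
  have ev: "eventually (\<lambda>t. (u t / (T - t)) powr (-2/3) = U t / (T - t) powr (-2/3)) (at_left T)"
    using eva
  proof eventually_elim
    case (elim t)
    then show ?case using Upos[OF elim] by (simp add: u_def powr_divide powr_powr)
  qed
  ultimately show ?thesis using k tendsto_cong[OF ev] by (simp add: powr_powr)
qed


section \<open>The cluster under an external force\<close>

lemma sum_ordered_pairs:
  fixes g :: "nat \<Rightarrow> nat \<Rightarrow> real"
  assumes fin: "finite I"
  shows "(\<Sum>i\<in>I. \<Sum>j\<in>I - {i}. g i j)
       = (\<Sum>(i,j)\<in>{(i,j). i \<in> I \<and> j \<in> I \<and> i < j}. g i j + g j i)"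
proof -
  let ?P = "{(i,j). i \<in> I \<and> j \<in> I \<and> i < j}"
  let ?Q = "{(i,j). i \<in> I \<and> j \<in> I \<and> j < i}"
  have sub: "?P \<subseteq> I \<times> I" "?Q \<subseteq> I \<times> I" by auto
  have finPQ: "finite ?P" "finite ?Q"
    using finite_subset[OF sub(1)] finite_subset[OF sub(2)] fin by auto
  have "(\<Sum>i\<in>I. \<Sum>j\<in>I - {i}. g i j) = (\<Sum>(i,j)\<in>(SIGMA i:I. I - {i}). g i j)"
    using fin by (intro sum.Sigma) auto
  also have "(SIGMA i:I. I - {i}) = ?P \<union> ?Q" by auto
  also have "(\<Sum>(i,j)\<in>?P \<union> ?Q. g i j) = (\<Sum>(i,j)\<in>?P. g i j) + (\<Sum>(i,j)\<in>?Q. g i j)"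
    by (rule sum.union_disjoint) (use finPQ in auto)
  also have "(\<Sum>(i,j)\<in>?Q. g i j) = (\<Sum>(i,j)\<in>?P. g j i)"
    by (rule sum.reindex_bij_witness[of _ prod.swap prod.swap]) auto
  finally show ?thesis by (simp add: sum.distrib case_prod_unfold)
qed

text \<open>The directional derivative of \<open>pot\<close> at \<open>x\<close> along
  \<open>w\<close>. It is taken along velocities for the energy and along positions for the
  virial.\<close>

definition dpot :: "(nat \<Rightarrow> real) \<Rightarrow> nat set \<Rightarrow> (nat \<Rightarrow> 'v::real_inner) \<Rightarrow> (nat \<Rightarrow> 'v) \<Rightarrow> real" where
  "dpot m I x w = (\<Sum>(i,j)\<in>{(i,j). i \<in> I \<and> j \<in> I \<and> i < j}.
     - (m i * m j / norm (x i - x j) ^ 3 * inner (x i - x j) (w i - w j)))"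

text \<open>\<open>accel\<close> with an arbitrary set of sources, so that the acceleration splits
  into a part from inside the cluster and a part from outside.\<close>

definition grav :: "(nat \<Rightarrow> real) \<Rightarrow> nat set \<Rightarrow> (nat \<Rightarrow> 'v::real_normed_vector) \<Rightarrow> nat \<Rightarrow> 'v" where
  "grav m I x i = (\<Sum>j\<in>I - {i}. (m j / norm (x j - x i) ^ 3) *\<^sub>R (x j - x i))"

text \<open>Newton's third law: the two forces of a pair are opposite, so their contributions
  combine into one term with \<open>w i - w j\<close>.\<close>

lemma sum_inner_grav:
  fixes x w :: "nat \<Rightarrow> 'v::real_inner"
  assumes fin: "finite I"
  shows "(\<Sum>i\<in>I. m i * inner (w i) (grav m I x i)) = dpot m I x w"
proof -
  have "(\<Sum>i\<in>I. m i * inner (w i) (grav m I x i))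
      = (\<Sum>i\<in>I. \<Sum>j\<in>I - {i}. m i * m j / norm (x j - x i) ^ 3 * inner (w i) (x j - x i))"
    by (simp add: grav_def inner_sum_right sum_distrib_left mult_ac)
  also have "\<dots> = dpot m I x w"
    unfolding sum_ordered_pairs[OF fin] dpot_def
  proof (intro sum.cong refl, clarify)
    fix i j
    have n: "norm (x j - x i) = norm (x i - x j)" by (rule norm_minus_commute)
    show "m i * m j / norm (x j - x i) ^ 3 * inner (w i) (x j - x i) +
        m j * m i / norm (x i - x j) ^ 3 * inner (w j) (x i - x j) =
        - (m i * m j / norm (x i - x j) ^ 3 * inner (x i - x j) (w i - w j))"
      unfolding n by (simp add: inner_diff inner_commute algebra_simps add_divide_distrib diff_divide_distrib)
  qed
  finally show ?thesis .
qed

text \<open>Euler's identity for a function homogeneous of degree -1; translation invariance makes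
  the centre \<open>c\<close> arbitrary.\<close>

lemma dpot_self:
  assumes "finite I"
  shows "dpot m I x (\<lambda>i. x i - c) = - pot m I x"
  unfolding dpot_def pot_def sum_negf[symmetric]
proof (intro sum.cong refl, clarify)
  fix i j
  have *: "inner (x i - x j) (x i - c - (x j - c)) = norm (x i - x j) ^ 2"
    by (simp add: power2_norm_eq_inner)
  show "- (m i * m j / norm (x i - x j) ^ 3 * inner (x i - x j) (x i - c - (x j - c))) =
       - (m i * m j / norm (x i - x j))"
    unfolding * by (simp add: power2_eq_square power3_eq_cube)
qed

section \<open>Derivatives along a motion\<close>

lemma has_real_derivative_inner:
  fixes f g :: "real \<Rightarrow> 'v::real_inner"
  assumes "(f has_vector_derivative f') (at t)" "(g has_vector_derivative g') (at t)"
  shows "((\<lambda>t. inner (f t) (g t)) has_real_derivative inner (f t) g' + inner f' (g t)) (at t)"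
  unfolding has_real_derivative_iff_has_vector_derivative
  by (rule bounded_bilinear.has_vector_derivative[OF bounded_bilinear_inner assms])

lemma has_real_derivative_norm_squared:
  fixes f :: "real \<Rightarrow> 'v::real_inner"
  assumes "(f has_vector_derivative f') (at t)"
  shows "((\<lambda>t. (norm (f t))\<^sup>2) has_real_derivative 2 * inner (f t) f') (at t)"
  using has_real_derivative_inner[OF assms assms]
  by (simp add: power2_norm_eq_inner inner_commute)

lemma has_real_derivative_norm:
  fixes f :: "real \<Rightarrow> 'v::real_inner"
  assumes "(f has_vector_derivative f') (at t)" "f t \<noteq> 0"
  shows "((\<lambda>t. norm (f t)) has_real_derivative inner (f t) f' / norm (f t)) (at t)"
  using has_real_derivative_sqrt_comp[OF has_real_derivative_norm_squared[OF assms(1)]] assms(2)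
  by simp

lemma has_real_derivative_Jfun:
  fixes x :: "real \<Rightarrow> nat \<Rightarrow> 'v::real_inner"
  assumes "\<And>i. i \<in> I \<Longrightarrow> ((\<lambda>t. x t i) has_vector_derivative w i) (at t)"
  shows "((\<lambda>t. Jfun m I L (x t)) has_real_derivative 2 * (\<Sum>i\<in>I. m i * inner (x t i - L i) (w i))) (at t)"
  unfolding Jfun_def sum_distrib_left
proof (rule DERIV_sum)
  fix i assume "i \<in> I"
  from assms[OF this] have "((\<lambda>t. x t i - L i) has_vector_derivative w i) (at t)"
    by (auto intro!: derivative_eq_intros)
  from DERIV_cmult[OF has_real_derivative_norm_squared[OF this], of "m i"]
  show "((\<lambda>t. m i * (norm (x t i - L i))\<^sup>2) has_real_derivative
      2 * (m i * inner (x t i - L i) (w i))) (at t)"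
    by (simp add: mult_ac)
qed

lemma has_real_derivative_kin:
  fixes v :: "real \<Rightarrow> nat \<Rightarrow> 'v::real_inner"
  assumes "\<And>i. i \<in> I \<Longrightarrow> ((\<lambda>t. v t i) has_vector_derivative a i) (at t)"
  shows "((\<lambda>t. kin m I (v t)) has_real_derivative (\<Sum>i\<in>I. m i * inner (v t i) (a i))) (at t)"
proof -
  have "((\<lambda>t. 1/2 * Jfun m I (\<lambda>i. 0) (v t)) has_real_derivative
      1/2 * (2 * (\<Sum>i\<in>I. m i * inner (v t i - 0) (a i)))) (at t)"
    by (intro DERIV_cmult has_real_derivative_Jfun assms)
  then show ?thesis by (simp add: Jfun_def kin_def)
qed

lemma has_real_derivative_pot:
  fixes x :: "real \<Rightarrow> nat \<Rightarrow> 'v::real_inner"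
  assumes der: "\<And>i. i \<in> I \<Longrightarrow> ((\<lambda>t. x t i) has_vector_derivative w i) (at t)"
    and ne: "\<And>i j. i \<in> I \<Longrightarrow> j \<in> I \<Longrightarrow> i \<noteq> j \<Longrightarrow> x t i \<noteq> x t j"
  shows "((\<lambda>t. pot m I (x t)) has_real_derivative dpot m I (x t) w) (at t)"
  unfolding pot_def dpot_def
proof (rule DERIV_sum, clarsimp)
  fix i j assume ij: "i \<in> I" "j \<in> I" "i < j"
  then have nz: "x t i - x t j \<noteq> 0" using ne[of i j] by auto
  have "((\<lambda>t. x t i - x t j) has_vector_derivative w i - w j) (at t)"
    by (intro has_vector_derivative_diff der ij)
  from has_real_derivative_norm[OF this nz] nz
  show "((\<lambda>t. m i * m j / norm (x t i - x t j)) has_real_derivative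
      - (m i * m j * inner (x t i - x t j) (w i - w j) / norm (x t i - x t j) ^ 3)) (at t)"
    by (auto intro!: derivative_eq_intros simp: power3_eq_cube)
qed

section \<open>Estimates in terms of \<open>J\<close>, \<open>K\<close> and \<open>U\<close>\<close>

lemma norm_le_sqrt_Jfun:
  assumes "finite I" and mpos: "\<And>i. i \<in> I \<Longrightarrow> m i > 0" and i: "i \<in> I"
  shows "norm (x i - L i) \<le> 1 / sqrt (m i) * sqrt (Jfun m I L x)"
proof -
  have "m i * (norm (x i - L i))\<^sup>2 \<le> Jfun m I L x"
    unfolding Jfun_def using assms
    by (intro member_le_sum[of i I "\<lambda>i. m i * (norm (x i - L i))\<^sup>2"]) (auto simp: less_imp_le)
  then have "(norm (x i - L i))\<^sup>2 \<le> Jfun m I L x / m i"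
    using mpos[OF i] by (simp add: field_simps)
  then have "norm (x i - L i) \<le> sqrt (Jfun m I L x / m i)"
    by (rule real_le_rsqrt)
  then show ?thesis by (simp add: real_sqrt_divide)
qed

lemma norm_le_sqrt_kin:
  fixes w :: "nat \<Rightarrow> 'v::real_inner"
  assumes "finite I" "\<And>i. i \<in> I \<Longrightarrow> m i > 0" "i \<in> I"
  shows "norm (w i) \<le> 1 / sqrt (m i) * sqrt (2 * kin m I w)"
  using norm_le_sqrt_Jfun[OF assms, where x = w and L = "\<lambda>_. 0"] by (simp add: Jfun_def kin_def)

lemma pair_le_pot:
  assumes "finite I" and mpos: "\<And>i. i \<in> I \<Longrightarrow> m i > 0" and ij: "i \<in> I" "j \<in> I" "i < j"
  shows "m i * m j / norm (x i - x j) \<le> pot m I x"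
proof -
  have "finite {(i,j). i \<in> I \<and> j \<in> I \<and> i < j}"
    by (rule finite_subset[of _ "I \<times> I"]) (use assms(1) in auto)
  moreover have "0 \<le> m a * m b / norm (x a - x b)" if "a \<in> I" "b \<in> I" for a b
    using mpos that by (simp add: less_imp_le)
  ultimately have "(\<lambda>(i,j). m i * m j / norm (x i - x j)) (i, j) \<le> pot m I x"
    unfolding pot_def
    by (intro member_le_sum[of "(i, j)" "{(i,j). i \<in> I \<and> j \<in> I \<and> i < j}"
          "\<lambda>(i,j). m i * m j / norm (x i - x j)"]) (use ij in auto)
  then show ?thesis by simp
qed

text \<open>In each pair term one factor \<open>1 / norm (x i - x j)\<close> is lost to
  Cauchy-Schwarz; the remaining two are controlled by \<open>pot\<close> and the relative velocity
  by \<open>kin\<close>. Where \<open>kin \<le> 2 * pot\<close>, this is the \<open>5/2\<close>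
  power bound on the derivative of \<open>pot\<close>.\<close>

lemma abs_dpot_le:
  assumes fin: "finite I" and mpos: "\<And>i. i \<in> I \<Longrightarrow> m i > 0"
  shows "\<bar>dpot m I x w\<bar> \<le> (\<Sum>(i,j)\<in>{(i,j). i \<in> I \<and> j \<in> I \<and> i < j}.
           (1 / sqrt (m i) + 1 / sqrt (m j)) / (m i * m j)) * (pot m I x)\<^sup>2 * sqrt (2 * kin m I w)"
  unfolding dpot_def sum_distrib_right
proof (rule order_trans[OF sum_abs sum_mono])
  fix p assume "p \<in> {(i,j). i \<in> I \<and> j \<in> I \<and> i < j}"
  then obtain i j where p: "p = (i, j)" and ij: "i \<in> I" "j \<in> I" "i < j" by auto
  let ?r = "norm (x i - x j)" and ?U = "pot m I x" and ?K = "sqrt (2 * kin m I w)"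
  have pos: "m i > 0" "m j > 0" "m i * m j > 0" using mpos ij by auto
  have U: "m i * m j / ?r \<le> ?U" by (rule pair_le_pot) (use assms ij in auto)
  then have "(m i * m j / ?r)\<^sup>2 \<le> ?U\<^sup>2"
    using pos by (intro power_mono) auto
  then have A: "m i * m j / ?r\<^sup>2 \<le> ?U\<^sup>2 / (m i * m j)"
    using pos by (simp add: power_divide power2_eq_square field_simps)
  have "norm (w i - w j) \<le> norm (w i) + norm (w j)" by (rule norm_triangle_ineq4)
  also have "\<dots> \<le> 1 / sqrt (m i) * ?K + 1 / sqrt (m j) * ?K"
    by (intro add_mono norm_le_sqrt_kin fin mpos ij)
  finally have W: "norm (w i - w j) \<le> (1 / sqrt (m i) + 1 / sqrt (m j)) * ?K"
    by (simp add: distrib_right)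
  have "m i * m j * \<bar>inner (x i - x j) (w i - w j)\<bar> / ?r ^ 3
      \<le> m i * m j * (?r * norm (w i - w j)) / ?r ^ 3"
    using pos Cauchy_Schwarz_ineq2[of "x i - x j" "w i - w j"]
    by (intro divide_right_mono mult_left_mono) auto
  \<comment> \<open>For \<open>?r = 0\<close> both sides vanish, since division by 0 yields
    0.\<close>
  also have "\<dots> = m i * m j / ?r\<^sup>2 * norm (w i - w j)"
    by (cases "?r = 0") (simp_all add: power2_eq_square power3_eq_cube)
  also have "\<dots> \<le> ?U\<^sup>2 / (m i * m j) * ((1 / sqrt (m i) + 1 / sqrt (m j)) * ?K)"
    using pos by (intro mult_mono A W) auto
  finally show "\<bar>case p of (i, j) \<Rightarrow> - (m i * m j / norm (x i - x j) ^ 3 * inner (x i - x j) (w i - w j))\<bar> \<le>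
      (case p of (i, j) \<Rightarrow> (1 / sqrt (m i) + 1 / sqrt (m j)) / (m i * m j)) * ?U\<^sup>2 * ?K"
    using pos by (simp add: p abs_mult mult_ac)
qed

text \<open>Two bodies with a common limit point are within a multiple of \<open>sqrt J\<close> of
  each other, so their single pair term already gives the bound.\<close>

lemma pot_ge_Jfun:
  assumes fin: "finite I" and mpos: "\<And>i. i \<in> I \<Longrightarrow> m i > 0"
    and ij: "i \<in> I" "j \<in> I" "i < j" "x i \<noteq> x j" "L i = L j"
  shows "m i * m j / (1 / sqrt (m i) + 1 / sqrt (m j)) / sqrt (Jfun m I L x) \<le> pot m I x"
proof -
  have pos: "m i > 0" "m j > 0" using mpos ij by auto
  have "x i - x j = (x i - L i) - (x j - L j)" using ij by simp
  then have "norm (x i - x j) \<le> norm (x i - L i) + norm (x j - L j)"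
    by (metis norm_triangle_ineq4)
  also have "\<dots> \<le> 1 / sqrt (m i) * sqrt (Jfun m I L x) + 1 / sqrt (m j) * sqrt (Jfun m I L x)"
    by (intro add_mono norm_le_sqrt_Jfun fin mpos ij)
  also have "\<dots> = (1 / sqrt (m i) + 1 / sqrt (m j)) * sqrt (Jfun m I L x)"
    by (simp add: distrib_right)
  finally have le: "norm (x i - x j) \<le> (1 / sqrt (m i) + 1 / sqrt (m j)) * sqrt (Jfun m I L x)" .
  have "0 < norm (x i - x j)" using ij by simp
  then have "0 < (1 / sqrt (m i) + 1 / sqrt (m j)) * sqrt (Jfun m I L x)"
    using le by (rule less_le_trans)
  moreover have c0: "0 < 1 / sqrt (m i) + 1 / sqrt (m j)"
    using pos by (intro add_pos_pos) simp_all
  ultimately have J0: "0 < sqrt (Jfun m I L x)"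
    by (metis zero_less_mult_pos)
  have "m i * m j / ((1 / sqrt (m i) + 1 / sqrt (m j)) * sqrt (Jfun m I L x))
      \<le> m i * m j / norm (x i - x j)"
    using pos J0 c0 ij le by (intro divide_left_mono mult_pos_pos) simp_all
  also have "\<dots> \<le> pot m I x" by (rule pair_le_pot) (use assms in auto)
  finally show ?thesis by simp
qed

text \<open>Cauchy-Schwarz with each mass split as \<open>sqrt (m i) * sqrt (m i)\<close>. The 8 is
  the square of the 2 in \<open>J1\<close> times the 2 that undoes the half in
  \<open>kin\<close>.\<close>

lemma virial_Cauchy_Schwarz:
  fixes x w :: "nat \<Rightarrow> 'v::real_inner"
  assumes mpos: "\<And>i. i \<in> I \<Longrightarrow> m i > 0"
  shows "(2 * (\<Sum>i\<in>I. m i * inner (x i - L i) (w i)))\<^sup>2 \<le> 8 * Jfun m I L x * kin m I w"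
proof -
  let ?a = "\<lambda>i. sqrt (m i) * norm (x i - L i)" and ?b = "\<lambda>i. sqrt (m i) * norm (w i)"
  have "\<bar>\<Sum>i\<in>I. m i * inner (x i - L i) (w i)\<bar> \<le> (\<Sum>i\<in>I. ?a i * ?b i)"
  proof (rule order_trans[OF sum_abs sum_mono])
    fix i assume i: "i \<in> I"
    have "?a i * ?b i = m i * (norm (x i - L i) * norm (w i))"
      using mpos[OF i] by simp
    moreover have "m i * \<bar>inner (x i - L i) (w i)\<bar> \<le> m i * (norm (x i - L i) * norm (w i))"
      using mpos[OF i] by (intro mult_left_mono Cauchy_Schwarz_ineq2) simp
    moreover have "\<bar>m i * inner (x i - L i) (w i)\<bar> = m i * \<bar>inner (x i - L i) (w i)\<bar>"
      using mpos[OF i] by (simp add: abs_mult)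
    ultimately show "\<bar>m i * inner (x i - L i) (w i)\<bar> \<le> ?a i * ?b i" by (simp only:)
  qed
  then have "(\<Sum>i\<in>I. m i * inner (x i - L i) (w i))\<^sup>2 \<le> (\<Sum>i\<in>I. ?a i * ?b i)\<^sup>2"
    by (rule abs_le_square_iff[THEN iffD1, OF order_trans]) simp
  also have "\<dots> \<le> (\<Sum>i\<in>I. (?a i)\<^sup>2) * (\<Sum>i\<in>I. (?b i)\<^sup>2)"
    by (rule Cauchy_Schwarz_ineq_sum)
  also have "\<dots> = Jfun m I L x * (2 * kin m I w)"
    using mpos by (simp add: Jfun_def kin_def power_mult_distrib less_imp_le cong: sum.cong)
  finally show ?thesis by (simp add: power_mult_distrib mult_ac)
qed

section \<open>Internal and external forces\<close>

lemma grav_Un: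
  assumes "finite (I \<union> I')" "I \<inter> I' = {}"
  shows "grav m (I \<union> I') x i = grav m I x i + grav m I' x i"
  unfolding grav_def Un_Diff
  by (rule sum.union_disjoint) (use assms in auto)

lemma tendsto_grav:
  assumes lim: "\<And>j. j \<in> insert i I \<Longrightarrow> ((\<lambda>t. x t j) \<longlongrightarrow> L j) F"
    and ne: "\<And>j. j \<in> I - {i} \<Longrightarrow> L j \<noteq> L i"
  shows "((\<lambda>t. grav m I (x t) i) \<longlongrightarrow> grav m I L i) F"
  unfolding grav_def
proof (rule tendsto_sum)
  fix j assume j: "j \<in> I - {i}"
  then have "norm (L j - L i) ^ 3 \<noteq> 0" using ne by simp
  then show "((\<lambda>t. (m j / norm (x t j - x t i) ^ 3) *\<^sub>R (x t j - x t i))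
      \<longlongrightarrow> (m j / norm (L j - L i) ^ 3) *\<^sub>R (L j - L i)) F"
    using j by (intro tendsto_scaleR tendsto_divide tendsto_power tendsto_norm tendsto_diff
      tendsto_const lim) auto
qed

section \<open>The cluster in the n-body problem\<close>

theorem theoremB1:
  fixes q v :: "real \<Rightarrow> nat \<Rightarrow> real ^ 'd"
    and m :: "nat \<Rightarrow> real"
    and n :: nat and t0 T :: real
    and L :: "nat \<Rightarrow> real ^ 'd"
    and G :: "nat set"
  assumes dim: "CARD('d) = 2 \<or> CARD('d) = 3"
    and n2: "n \<ge> 2"
    and mpos: "\<forall>i\<in>{1..n}. m i > 0"
    and t0T: "t0 < T"
    and vel: "\<forall>t\<in>{t0..<T}. \<forall>i\<in>{1..n}.
                ((\<lambda>s. q s i) has_vector_derivative v t i) (at t within {t0..<T})"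
    and newton: "\<forall>t\<in>{t0..<T}. \<forall>i\<in>{1..n}.
                ((\<lambda>s. v s i) has_vector_derivative accel m n (q t) i) (at t within {t0..<T})"
    and nocoll: "\<forall>t\<in>{t0..<T}. \<forall>i\<in>{1..n}. \<forall>j\<in>{1..n}. i \<noteq> j \<longrightarrow> q t i \<noteq> q t j"
    and lim: "\<forall>i\<in>{1..n}. ((\<lambda>t. q t i) \<longlongrightarrow> L i) (at_left T)"
    and Gsub: "G \<subseteq> {1..n}" and Gcard: "card G \<ge> 2"
    and cluster: "\<exists>LG. (\<forall>i\<in>G. L i = LG) \<and> (\<forall>j\<in>{1..n} - G. L j \<noteq> LG)"
  shows "\<exists>A>0.
     ((\<lambda>t. Jfun m G L (q t) / (T - t) powr (4/3)) \<longlongrightarrow> A) (at_left T) \<and>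
     ((\<lambda>t. deriv (\<lambda>s. Jfun m G L (q s)) t / (T - t) powr (1/3)) \<longlongrightarrow> - 4 * A / 3) (at_left T) \<and>
     ((\<lambda>t. deriv (deriv (\<lambda>s. Jfun m G L (q s))) t / (T - t) powr (-2/3)) \<longlongrightarrow> 4 * A / 9) (at_left T) \<and>
     ((\<lambda>t. pot m G (q t) / (T - t) powr (-2/3)) \<longlongrightarrow> 2 * A / 9) (at_left T) \<and>
     ((\<lambda>t. kin m G (v t) / (T - t) powr (-2/3)) \<longlongrightarrow> 2 * A / 9) (at_left T) \<and>
     (\<exists>h. ((\<lambda>t. kin m G (v t) - pot m G (q t)) \<longlongrightarrow> h) (at_left T))"
proof -
  let ?E = "{1..n} - G"
  have finG: "finite G" using Gsub finite_subset by blast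
  have mG: "m i > 0" if "i \<in> G" for i using mpos Gsub that by auto
  obtain LG where LG: "\<And>i. i \<in> G \<Longrightarrow> L i = LG" "\<And>j. j \<in> ?E \<Longrightarrow> L j \<noteq> LG"
    using cluster by auto
  obtain i0 j0 where ij: "i0 \<in> G" "j0 \<in> G" "i0 < j0"
  proof -
    have "\<not> card G \<le> 1" using Gcard by simp
    then obtain i j where "i \<in> G" "j \<in> G" "i \<noteq> j"
      by (metis finG card_le_Suc0_iff_eq One_nat_def)
    then show thesis using that by (metis linorder_neqE_nat)
  qed
  have at: "at t within {t0..<T} = at t" if "t \<in> {t0<..<T}" for t
    using that by (intro at_within_interior) auto
  have q': "((\<lambda>s. q s i) has_vector_derivative v t i) (at t)" if "t \<in> {t0<..<T}" "i \<in> G" for t i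
    using vel[rule_format, of t i] that Gsub at[OF that(1)] by auto
  define f where "f t i = grav m ?E (q t) i" for t i
  have acc: "accel m n (q t) i = grav m G (q t) i + f t i" if "i \<in> G" for t i
  proof -
    have "accel m n (q t) i = grav m (G \<union> ?E) (q t) i"
      using Gsub by (simp add: accel_def grav_def Un_absorb1)
    also have "\<dots> = grav m G (q t) i + grav m ?E (q t) i"
      by (rule grav_Un) (use finG in auto)
    finally show ?thesis by (simp add: f_def)
  qed
  have v': "((\<lambda>s. v s i) has_vector_derivative grav m G (q t) i + f t i) (at t)"
    if "t \<in> {t0<..<T}" "i \<in> G" for t i
    using newton[rule_format, of t i] that Gsub at[OF that(1)] acc[OF that(2)] by auto
  have ne: "q t i \<noteq> q t j" if "t \<in> {t0<..<T}" "i \<in> G" "j \<in> G" "i \<noteq> j" for t i j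
    using nocoll[rule_format, of t i j] that subsetD[OF Gsub that(2)] subsetD[OF Gsub that(3)] by auto

  define J where "J t = Jfun m G L (q t)" for t
  define U where "U t = pot m G (q t)" for t
  define K where "K t = kin m G (v t)" for t
  define H where "H t = K t - U t" for t
  \<comment> \<open>\<open>e\<close> is the contribution of the external forces to
    \<open>J''\<close>, and \<open>H1\<close> is their power.\<close>
  define e where "e t = 2 * (\<Sum>i\<in>G. m i * inner (q t i - L i) (f t i))" for t
  define H1 where "H1 t = (\<Sum>i\<in>G. m i * inner (v t i) (f t i))" for t
  define J1 where "J1 t = 2 * (\<Sum>i\<in>G. m i * inner (q t i - L i) (v t i))" for t
  define J2 where "J2 t = 2 * K t + 2 * H t + e t" for t
  have J': "(J has_real_derivative J1 t) (at t)" if "t \<in> {t0<..<T}" for t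
    unfolding J_def[abs_def] J1_def by (intro has_real_derivative_Jfun q' that)
  have K': "(K has_real_derivative (\<Sum>i\<in>G. m i * inner (v t i) (grav m G (q t) i + f t i))) (at t)"
    if "t \<in> {t0<..<T}" for t
    unfolding K_def[abs_def] by (intro has_real_derivative_kin v' that)
  have U': "(U has_real_derivative dpot m G (q t) (v t)) (at t)" if "t \<in> {t0<..<T}" for t
    unfolding U_def[abs_def] by (intro has_real_derivative_pot q' ne that)
  \<comment> \<open>The power of the internal forces equals the derivative of \<open>U\<close>, so
    only the external power survives in \<open>H'\<close>.\<close>
  have H': "(H has_real_derivative H1 t) (at t)" if t: "t \<in> {t0<..<T}" for t
  proof -
    have "H1 t = (\<Sum>i\<in>G. m i * inner (v t i) (grav m G (q t) i + f t i)) - dpot m G (q t) (v t)"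
      unfolding sum_inner_grav[OF finG, symmetric] H1_def
      by (simp add: inner_add_right distrib_left sum.distrib)
    with DERIV_diff[OF K'[OF t] U'[OF t]] show ?thesis by (simp add: H_def[abs_def])
  qed
  have J'': "(J1 has_real_derivative J2 t) (at t)" if t: "t \<in> {t0<..<T}" for t
  proof -
    have "(J1 has_real_derivative 2 * (\<Sum>i\<in>G. m i * (inner (q t i - L i) (grav m G (q t) i + f t i)
        + inner (v t i) (v t i)))) (at t)"
      unfolding J1_def[abs_def]
    proof (intro DERIV_cmult DERIV_sum has_real_derivative_inner v' t)
      fix i assume "i \<in> G"
      from q'[OF t this] show "((\<lambda>t. q t i - L i) has_vector_derivative v t i) (at t)"
        by (auto intro!: derivative_eq_intros)
    qed
    also have "2 * (\<Sum>i\<in>G. m i * (inner (q t i - L i) (grav m G (q t) i + f t i) + inner (v t i) (v t i)))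
        = 2 * (\<Sum>i\<in>G. m i * inner (q t i - L i) (grav m G (q t) i)) + e t + 4 * K t"
      by (simp add: e_def K_def kin_def inner_add_right distrib_left sum.distrib power2_norm_eq_inner)
    \<comment> \<open>The common limit \<open>LG\<close> turns the individual centres
      \<open>L i\<close> into a single one, as Euler's identity requires.\<close>
    also have "(\<Sum>i\<in>G. m i * inner (q t i - L i) (grav m G (q t) i))
        = (\<Sum>i\<in>G. m i * inner (q t i - LG) (grav m G (q t) i))"
      using LG by simp
    also have "\<dots> = - U t"
      unfolding sum_inner_grav[OF finG] dpot_self[OF finG] U_def ..
    also have "2 * (- U t) + e t + 4 * K t = J2 t"
      by (simp add: J2_def H_def)
    finally show ?thesis .
  qed

  define M where "M = sum m G"
  have M0: "M \<ge> 0" unfolding M_def using mG by (intro sum_nonneg) (simp add: less_imp_le)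
  \<comment> \<open>The \<open>+ 1\<close> makes the bound strict at the limiting forces, so it
    holds eventually along the motion.\<close>
  define F where "F = Max ((\<lambda>i. norm (grav m ?E L i)) ` G) + 1"
  have F0: "F \<ge> 0"
  proof -
    have "norm (grav m ?E L i0) \<le> Max ((\<lambda>i. norm (grav m ?E L i)) ` G)"
      using finG ij by (intro Max_ge) auto
    then show ?thesis unfolding F_def using norm_ge_zero[of "grav m ?E L i0"] by linarith
  qed
  have limq: "((\<lambda>t. q t i) \<longlongrightarrow> L i) (at_left T)" if "i \<in> {1..n}" for i using lim that by auto
  have "eventually (\<lambda>t. norm (f t i) < F \<and> norm (q t i - L i) < 1) (at_left T)" if i: "i \<in> G" for i
  proof (rule eventually_conj)
    have "((\<lambda>t. grav m ?E (q t) i) \<longlongrightarrow> grav m ?E L i) (at_left T)"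
    proof (rule tendsto_grav)
      show "((\<lambda>t. q t j) \<longlongrightarrow> L j) (at_left T)" if "j \<in> insert i ?E" for j
        by (rule limq) (use that i Gsub in auto)
      show "L j \<noteq> L i" if "j \<in> ?E - {i}" for j using LG i that by auto
    qed
    then have "((\<lambda>t. norm (f t i)) \<longlongrightarrow> norm (grav m ?E L i)) (at_left T)"
      unfolding f_def by (rule tendsto_norm)
    moreover have "norm (grav m ?E L i) \<le> Max ((\<lambda>i. norm (grav m ?E L i)) ` G)"
      using finG i by (intro Max_ge) auto
    then have "norm (grav m ?E L i) < F" by (simp add: F_def)
    ultimately show "eventually (\<lambda>t. norm (f t i) < F) (at_left T)"
      by (rule order_tendstoD(2))
    have "((\<lambda>t. norm (q t i - L i)) \<longlongrightarrow> norm (L i - L i)) (at_left T)"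
      by (intro tendsto_intros limq) (use i Gsub in auto)
    then show "eventually (\<lambda>t. norm (q t i - L i) < 1) (at_left T)"
      by (intro order_tendstoD(2)) auto
  qed
  then have "eventually (\<lambda>t. \<forall>i\<in>G. norm (f t i) < F \<and> norm (q t i - L i) < 1) (at_left T)"
    using finG by (intro eventually_ball_finite) auto
  then obtain a0 where a0: "a0 < T"
      "\<And>t i. a0 < t \<Longrightarrow> t < T \<Longrightarrow> i \<in> G \<Longrightarrow> norm (f t i) < F \<and> norm (q t i - L i) < 1"
    unfolding eventually_at_left_field by blast
  define a where "a = max t0 a0"
  have a: "a < T" using a0 t0T by (simp add: a_def)
  have at0: "t \<in> {t0<..<T}" if "t \<in> {a<..<T}" for t using that by (auto simp: a_def)
  have fF: "norm (f t i) \<le> F" "norm (q t i - L i) \<le> 1" if "t \<in> {a<..<T}" "i \<in> G" for t i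
    using a0(2)[of t i] that by (auto simp: a_def)
  have inner_le: "\<bar>\<Sum>i\<in>G. m i * inner (w i) (f t i)\<bar> \<le> (\<Sum>i\<in>G. m i * norm (w i)) * F"
    if t: "t \<in> {a<..<T}" for t w
    unfolding sum_distrib_right
  proof (rule order_trans[OF sum_abs sum_mono])
    fix i assume i: "i \<in> G"
    have "\<bar>inner (w i) (f t i)\<bar> \<le> norm (w i) * norm (f t i)" by (rule Cauchy_Schwarz_ineq2)
    also have "\<dots> \<le> norm (w i) * F" using fF[OF t i] by (intro mult_left_mono) auto
    finally have "m i * \<bar>inner (w i) (f t i)\<bar> \<le> m i * (norm (w i) * F)"
      using mG[OF i] by (intro mult_left_mono) auto
    then show "\<bar>m i * inner (w i) (f t i)\<bar> \<le> m i * norm (w i) * F"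
      using mG[OF i] by (simp add: abs_mult mult.assoc)
  qed
  have K0: "K t \<ge> 0" for t
    unfolding K_def kin_def using mG by (auto intro!: sum_nonneg simp: less_imp_le)
  \<comment> \<open>One constant for both estimates: \<open>\<bar>e t\<bar> \<le> 2 * M * F\<close>
    and \<open>\<bar>H1 t\<bar> \<le> (M + 2 * K t) * F\<close>.\<close>
  define C where "C = 2 * F * (M + 1)"
  have C0: "C \<ge> 0" using F0 M0 by (simp add: C_def)
  have e_le: "\<bar>e t\<bar> \<le> C" if t: "t \<in> {a<..<T}" for t
  proof -
    have "(\<Sum>i\<in>G. m i * norm (q t i - L i)) \<le> M"
      unfolding M_def
    proof (rule sum_mono)
      fix i assume i: "i \<in> G"
      show "m i * norm (q t i - L i) \<le> m i"
        using mult_left_mono[OF fF(2)[OF t i], of "m i"] mG[OF i] by simp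
    qed
    then have "(\<Sum>i\<in>G. m i * norm (q t i - L i)) * F \<le> M * F"
      using F0 by (rule mult_right_mono)
    moreover have "C = 2 * (M * F) + 2 * F" by (simp add: C_def algebra_simps)
    ultimately show ?thesis
      using inner_le[OF t, of "\<lambda>i. q t i - L i"] F0 unfolding e_def by linarith
  qed
  have H1_le: "\<bar>H1 t\<bar> \<le> C * (1 + K t)" if t: "t \<in> {a<..<T}" for t
  proof -
    have "(\<Sum>i\<in>G. m i * norm (v t i)) \<le> (\<Sum>i\<in>G. m i * (1 + (norm (v t i))\<^sup>2))"
    proof (rule sum_mono, rule mult_left_mono)
      fix i assume i: "i \<in> G"
      show "norm (v t i) \<le> 1 + (norm (v t i))\<^sup>2"
        using zero_le_power2[of "norm (v t i) - 1", unfolded power2_diff] norm_ge_zero[of "v t i"]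
        by (simp only: one_power2 mult_1_right)
    qed (use mG in \<open>simp add: less_imp_le\<close>)
    also have "\<dots> = M + 2 * K t"
      by (simp add: M_def K_def kin_def distrib_left sum.distrib)
    finally have "(\<Sum>i\<in>G. m i * norm (v t i)) * F \<le> (M + 2 * K t) * F"
      using F0 by (rule mult_right_mono)
    also have "\<dots> \<le> (M + 2 * K t) * F + (M * F + 2 * F + 2 * (M * F * K t))"
      using F0 M0 K0[of t] by simp
    also have "\<dots> = C * (1 + K t)" by (simp add: C_def algebra_simps)
    finally show ?thesis using inner_le[OF t, of "v t"] unfolding H1_def by linarith
  qed
  define \<gamma> where "\<gamma> = m i0 * m j0 / (1 / sqrt (m i0) + 1 / sqrt (m j0))"
  have \<gamma>: "\<gamma> > 0" unfolding \<gamma>_def using mG ij by (auto intro!: divide_pos_pos mult_pos_pos add_pos_pos)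
  have Uge: "\<gamma> / sqrt (J t) \<le> U t" if "t \<in> {t0<..<T}" for t
    unfolding \<gamma>_def J_def U_def
    by (rule pot_ge_Jfun) (use finG mG ij ne[OF that, of i0 j0] LG in auto)
  \<comment> \<open>\<open>J t = 0\<close> would put \<open>i0\<close> and \<open>j0\<close> both at
    \<open>LG\<close>, a collision before \<open>T\<close>.\<close>
  have Jpos: "J t > 0" if t: "t \<in> {t0<..<T}" for t
  proof -
    have J0: "J t \<ge> 0" unfolding J_def Jfun_def using mG by (auto intro!: sum_nonneg simp: less_imp_le)
    have "q t i = L i" if "J t = 0" "i \<in> G" for i
      using norm_le_sqrt_Jfun[where m = m and x = "q t" and L = L, OF finG mG that(2)] that(1) by (simp add: J_def)
    then have "J t \<noteq> 0" using ne[OF t, of i0 j0] ij LG by force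
    with J0 show ?thesis by simp
  qed
  have "((\<lambda>t. Jfun m G L (q t)) \<longlongrightarrow> (\<Sum>i\<in>G. m i * (norm (L i - L i))\<^sup>2)) (at_left T)"
    unfolding Jfun_def by (intro tendsto_intros limq) (use Gsub in auto)
  then have Jlim: "(J \<longlongrightarrow> 0) (at_left T)" by (simp add: J_def[abs_def])
  have "\<exists>h. (H \<longlongrightarrow> h) (at_left T)"
  proof (rule energy_tendsto[where C = C and J = J and ?J1.0 = J1 and K = K and e = e and ?H1.0 = H1])
    show "continuous_on {a<..<T} K"
      using K'[OF at0] by (intro continuous_at_imp_continuous_on ballI) (blast dest: DERIV_isCont)
  qed (use a J' J'' H' at0 Jpos K0 e_le H1_le Jlim in \<open>auto simp: J2_def\<close>)
  then obtain h where h: "(H \<longlongrightarrow> h) (at_left T)" by blast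

  \<comment> \<open>Near \<open>T\<close>, \<open>c\<close> bounds \<open>\<bar>H\<bar>\<close>, and
    smallness of \<open>J\<close> pushes \<open>U\<close> above \<open>c\<close>; together these
    give \<open>K = H + U \<le> 2 * U\<close>.\<close>
  define c where "c = \<bar>h\<bar> + 1"
  have c: "c > 0" by (simp add: c_def)
  have "eventually (\<lambda>t. \<bar>H t\<bar> < c) (at_left T)"
    by (rule order_tendstoD(2)[OF tendsto_rabs[OF h]]) (simp add: c_def)
  moreover have "((\<lambda>t. c * sqrt (J t)) \<longlongrightarrow> c * sqrt 0) (at_left T)"
    by (intro tendsto_intros Jlim)
  then have "eventually (\<lambda>t. c * sqrt (J t) < \<gamma>) (at_left T)"
    using \<gamma> by (intro order_tendstoD(2)) auto
  ultimately have "eventually (\<lambda>t. \<bar>H t\<bar> < c \<and> c * sqrt (J t) < \<gamma>) (at_left T)"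
    by (rule eventually_conj)
  then obtain b0 where b0: "b0 < T" "\<And>t. b0 < t \<Longrightarrow> t < T \<Longrightarrow> \<bar>H t\<bar> < c \<and> c * sqrt (J t) < \<gamma>"
    unfolding eventually_at_left_field by blast
  define b where "b = max a b0"
  have b: "b < T" using b0 a by (simp add: b_def)
  have ba: "t \<in> {a<..<T}" if "t \<in> {b<..<T}" for t using that by (auto simp: b_def)
  have bt: "t \<in> {t0<..<T}" if "t \<in> {b<..<T}" for t using at0 ba that by blast
  have Hc: "\<bar>H t\<bar> < c" and Uc: "c < U t" if t: "t \<in> {b<..<T}" for t
  proof -
    show "\<bar>H t\<bar> < c" using b0(2)[of t] t by (auto simp: b_def)
    have "c < \<gamma> / sqrt (J t)"
      using b0(2)[of t] t Jpos[OF bt[OF t]] by (auto simp: b_def field_simps)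
    then show "c < U t" using Uge[OF bt[OF t]] by linarith
  qed
  \<comment> \<open>The 4 comes from rewriting \<open>J2 = 2 * K + 2 * H + e\<close> as
    \<open>2 * U + 4 * H + e\<close>.\<close>
  define C' where "C' = C + 4 * c"
  have JU: "\<bar>J2 t - 2 * U t\<bar> \<le> C'" if t: "t \<in> {b<..<T}" for t
  proof -
    have "J2 t - 2 * U t = 4 * H t + e t" by (simp add: J2_def H_def)
    then show ?thesis using Hc[OF t] e_le[OF ba[OF t]] unfolding C'_def by linarith
  qed
  have JK: "2 * K t - C' \<le> J2 t" if t: "t \<in> {b<..<T}" for t
    using Hc[OF t] e_le[OF ba[OF t]] c unfolding C'_def J2_def by linarith
  have JU': "2 * U t - C' \<le> J2 t" if "t \<in> {b<..<T}" for t using JU[OF that] by linarith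
  have "\<exists>A>0. ((\<lambda>t. J t / (T - t) powr (4/3)) \<longlongrightarrow> A) (at_left T) \<and>
               ((\<lambda>t. J1 t / (T - t) powr (1/3)) \<longlongrightarrow> - 4 * A / 3) (at_left T)"
  proof (rule sundman_asymptotics[where K = K and U = U and C = C' and c = \<gamma> and ?J2.0 = J2 and a = b])
    show "(J1 t)\<^sup>2 \<le> 8 * J t * K t" for t
      unfolding J1_def J_def K_def by (rule virial_Cauchy_Schwarz) (rule mG)
  qed (use b bt Jpos J' J'' JK JU' Uge \<gamma> Jlim C0 c in \<open>auto simp: C'_def\<close>)
  then obtain A where A: "A > 0"
    and JA: "((\<lambda>t. J t / (T - t) powr (4/3)) \<longlongrightarrow> A) (at_left T)"
    and J1A: "((\<lambda>t. J1 t / (T - t) powr (1/3)) \<longlongrightarrow> - 4 * A / 3) (at_left T)"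
    by blast
  define B where "B = (\<Sum>(i,j)\<in>{(i,j). i \<in> G \<and> j \<in> G \<and> i < j}.
      (1 / sqrt (m i) + 1 / sqrt (m j)) / (m i * m j))"
  have U1: "\<bar>dpot m G (q t) (v t)\<bar> \<le> 2 * \<bar>B\<bar> * U t powr (5/2)" if t: "t \<in> {b<..<T}" for t
  proof -
    have U0: "U t > 0" using Uc[OF t] c by linarith
    have "K t \<le> 2 * U t" using Hc[OF t] Uc[OF t] unfolding H_def by linarith
    then have "sqrt (2 * K t) \<le> sqrt (2\<^sup>2 * U t)" by simp
    then have K2: "sqrt (2 * K t) \<le> 2 * sqrt (U t)" by (simp add: real_sqrt_mult)
    have "\<bar>dpot m G (q t) (v t)\<bar> \<le> B * (U t)\<^sup>2 * sqrt (2 * K t)"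
      unfolding B_def U_def K_def by (rule abs_dpot_le[OF finG]) (rule mG)
    also have "\<dots> \<le> \<bar>B\<bar> * (U t)\<^sup>2 * sqrt (2 * K t)"
      using K0[of t] by (intro mult_right_mono) auto
    also have "\<dots> \<le> \<bar>B\<bar> * (U t)\<^sup>2 * (2 * sqrt (U t))"
      by (intro mult_left_mono K2) simp
    also have "\<dots> = 2 * \<bar>B\<bar> * ((U t)\<^sup>2 * sqrt (U t))" by simp
    also have "(U t)\<^sup>2 * sqrt (U t) = U t powr 2 * U t powr (1/2)"
      using U0 by (simp add: powr_half_sqrt powr_numeral)
    also have "\<dots> = U t powr (5/2)" by (simp add: powr_add[symmetric])
    finally show ?thesis .
  qed
  \<comment> \<open>The Tauberian lemma is applied with \<open>k = 4 * A / 3\<close>, read off from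
    the asymptotics of \<open>J1\<close>.\<close>
  have UA: "((\<lambda>t. U t / (T - t) powr (-2/3)) \<longlongrightarrow> (4 * A / 3) / 6) (at_left T)"
  proof (rule potential_asymptotics[where a = b and C = C' and B = "2 * \<bar>B\<bar>" and ?J1.0 = J1 and ?J2.0 = J2
        and ?U1.0 = "\<lambda>t. dpot m G (q t) (v t)"])
    show "U t > 0" if "t \<in> {b<..<T}" for t using Uc[OF that] c by linarith
    show "((\<lambda>t. J1 t / (T - t) powr (1/3)) \<longlongrightarrow> - (4 * A / 3)) (at_left T)" using J1A by simp
  qed (use b bt J'' JU U' U1 A in auto)
  then have UA: "((\<lambda>t. U t / (T - t) powr (-2/3)) \<longlongrightarrow> 2 * A / 9) (at_left T)" by simp
  have evb: "eventually (\<lambda>t. t \<in> {b<..<T}) (at_left T)"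
    using b by (intro eventually_at_leftI[of b T]) simp_all
  have tau: "((\<lambda>t. T - t) \<longlongrightarrow> 0) (at_left T)"
    using tendsto_diff[OF tendsto_const[of T] tendsto_ident_at[of T "{..<T}"]] by simp
  have tau23: "((\<lambda>t. (T - t) powr (2/3)) \<longlongrightarrow> 0) (at_left T)"
    by (rule tendsto_zero_powrI[OF tau tendsto_const])
       (use evb in \<open>auto elim!: eventually_mono\<close>)
  have divide_tau: "x / (T - t) powr (-2/3) = x * (T - t) powr (2/3)" for x t
    using powr_minus_divide[of "T - t" "2/3"] by simp
  have HA: "((\<lambda>t. H t / (T - t) powr (-2/3)) \<longlongrightarrow> 0) (at_left T)"
    unfolding divide_tau using tendsto_mult[OF h tau23] by simp
  have eA: "((\<lambda>t. e t / (T - t) powr (-2/3)) \<longlongrightarrow> 0) (at_left T)"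
    unfolding divide_tau
  proof (rule tendsto_0_le[OF tau23])
    show "eventually (\<lambda>t. norm (e t * (T - t) powr (2/3)) \<le> norm ((T - t) powr (2/3)) * C) (at_left T)"
      using evb
    proof eventually_elim
      case (elim t)
      then show ?case using e_le[OF ba[OF elim]] by (simp add: abs_mult mult.commute mult_right_mono)
    qed
  qed
  have "((\<lambda>t. H t / (T - t) powr (-2/3) + U t / (T - t) powr (-2/3)) \<longlongrightarrow> 0 + 2 * A / 9) (at_left T)"
    by (intro tendsto_add HA UA)
  then have KA: "((\<lambda>t. K t / (T - t) powr (-2/3)) \<longlongrightarrow> 2 * A / 9) (at_left T)"
    by (simp add: H_def add_divide_distrib[symmetric])
  have "((\<lambda>t. 2 * (K t / (T - t) powr (-2/3)) + 2 * (H t / (T - t) powr (-2/3))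
      + e t / (T - t) powr (-2/3)) \<longlongrightarrow> 2 * (2 * A / 9) + 2 * 0 + 0) (at_left T)"
    by (intro tendsto_add tendsto_mult_left KA HA eA)
  then have J2A: "((\<lambda>t. J2 t / (T - t) powr (-2/3)) \<longlongrightarrow> 4 * A / 9) (at_left T)"
    by (simp add: J2_def add_divide_distrib)
  have dJ: "deriv J t = J1 t" if "t \<in> {t0<..<T}" for t
    by (rule DERIV_imp_deriv) (rule J'[OF that])
  \<comment> \<open>The outer \<open>deriv\<close> sees \<open>deriv J\<close> only near
    \<open>t\<close>, so agreement with \<open>J1\<close> on the open interval is enough.\<close>
  have ddJ: "deriv (deriv J) t = J2 t" if t: "t \<in> {t0<..<T}" for t
  proof -
    have "eventually (\<lambda>s. s \<in> {t0<..<T}) (nhds t)"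
      using t by (intro eventually_nhds_in_open) auto
    then have "eventually (\<lambda>s. deriv J s = J1 s) (nhds t)"
      by eventually_elim (rule dJ)
    then have "deriv (deriv J) t = deriv J1 t" by (intro deriv_cong_ev) simp_all
    then show ?thesis using DERIV_imp_deriv[OF J''[OF t]] by simp
  qed
  have ev1: "eventually (\<lambda>t. deriv J t / (T - t) powr (1/3) = J1 t / (T - t) powr (1/3)) (at_left T)"
    using evb by eventually_elim (use dJ bt in auto)
  have ev2: "eventually (\<lambda>t. deriv (deriv J) t / (T - t) powr (-2/3) = J2 t / (T - t) powr (-2/3)) (at_left T)"
    using evb by eventually_elim (use ddJ bt in auto)
  show ?thesis
    using A JA J1A[folded tendsto_cong[OF ev1]] J2A[folded tendsto_cong[OF ev2]] UA KA h
    unfolding J_def[abs_def] U_def[abs_def] K_def[abs_def] H_def[abs_def] by blast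
qed

end
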